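(* Let $\mathbf{k}$ be an algebraically closed field of characteristic $\neq 2,3$. Any $\mathrm{GL}_{\infty}$-stable subset of $P_3(\mathbf{k}^{\infty})$ containing forms of arbitrarily high q-rank (i.e. for every integer $N$ it contains a form of q-rank at least $N$, where q-rank $\infty$ is allowed) is Zariski dense in $P_3(\mathbf{k}^{\infty})$.
   Context: $\mathbf{k}^{\infty}=\bigcup_{n\ge 1}\mathbf{k}^n$ is the vector space with a countably infinite basis, and $\mathrm{GL}_{\infty}=\mathrm{GL}(\mathbf{k}^{\infty})$. For a $\mathbf{k}$-vector space $V$, $P_d(V)=\mathrm{Sym}^d(V)^*$ is the space of (homogeneous) degree $d$ polynomials on $V$, equipped with the Zariski topology by identifying it with the spectrum of the ring $\mathrm{Sym}(\mathrm{Sym}^d(V))$ (functions are polynomials in the coefficients); $P_d(\mathbf{k}^{\infty})$ is the inverse limit of the $P_d(\mathbf{k}^n)$. The q-rank of $f\in P_3(V)$ is the minimal non-negative integer $r$ for which there is an expression $f=\sum_{i=1}^r \ell_i q_i$ with $\ell_i\in P_1(V)$ and $q_i\in P_2(V)$, or $\infty$ if no such $r$ exists. *)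

theory Defs
  imports
    "HOL-Analysis.Abstract_Topology"
    "HOL-Library.Poly_Mapping"
    "HOL-Library.Multiset"
    "HOL-Library.Extended_Nat"
    "HOL-Computational_Algebra.Polynomial"
begin

type_synonym 'a kinf = "nat \<Rightarrow>\<^sub>0 'a"

definition kscale :: "'a::field \<Rightarrow> 'a kinf \<Rightarrow> 'a kinf" where
  "kscale a v = Poly_Mapping.map ((*) a) v"

lemma lookup_kscale [simp]: "Poly_Mapping.lookup (kscale a v) i = a * Poly_Mapping.lookup v i"
  unfolding kscale_def by transfer (simp add: when_def)

lemma vector_space_kscale: "vector_space (kscale :: 'a::field \<Rightarrow> _)"
  by unfold_locales (auto intro!: poly_mapping_eqI simp: lookup_add algebra_simps)

definition GL_inf :: "('a::field kinf \<Rightarrow> 'a kinf) set" where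
  "GL_inf = {g. Vector_Spaces.linear kscale kscale g \<and> bij g}"

text \<open>
  A monomial in the coordinates is a multiset of indices, its degree being the size of the
  multiset. A form on the whole space may involve infinitely many monomials: an element of the
  inverse limit of the spaces of forms in finitely many variables is an arbitrary family of
  coefficients indexed by the monomials of degree \<open>d\<close>. At a given vector, only the finitely many
  monomials in the coordinates of its support contribute to the value.
\<close>

definition form :: "nat \<Rightarrow> (nat multiset \<Rightarrow> 'a::field) \<Rightarrow> 'a kinf \<Rightarrow> 'a" where
  "form d c v = (\<Sum>m | size m = d \<and> set_mset m \<subseteq> Poly_Mapping.keys v.
                   c m * (\<Prod>i\<in>#m. Poly_Mapping.lookup v i))"

definition homog_poly :: "nat \<Rightarrow> ('a::field kinf \<Rightarrow> 'a) set" where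
  "homog_poly d = range (form d)"

text \<open>
  Over an infinite field a form is determined by its values, so its coefficients are well defined;
  see \<open>coeff_of_form\<close> below.
\<close>

definition coeff_of :: "nat \<Rightarrow> ('a::field kinf \<Rightarrow> 'a) \<Rightarrow> nat multiset \<Rightarrow> 'a" where
  "coeff_of d f = (THE c. (\<forall>m. size m \<noteq> d \<longrightarrow> c m = 0) \<and> form d c = f)"

lemma infinite_UNIV_alg_closed: "infinite (UNIV :: 'a::alg_closed_field set)"
proof
  assume fin: "finite (UNIV :: 'a set)"
  define q :: "'a poly" where "q = (\<Prod>a\<in>UNIV. [:-a, 1:])"
  have "degree q = card (UNIV :: 'a set)"
    unfolding q_def by (subst degree_prod_eq_sum_degree) auto
  hence deg: "degree q > 0"
    using fin by (simp add: card_gt_0_iff)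
  hence "degree (q + 1) > 0"
    by (subst degree_add_eq_left) auto
  then obtain x where "poly (q + 1) x = 0"
    using alg_closed_imp_poly_has_root by blast
  moreover have "poly q x = 0"
    unfolding q_def using fin by (auto simp: poly_prod intro!: prod_zero)
  ultimately show False by simp
qed

lemma finite_monomials: "finite A \<Longrightarrow> finite {m. size m = d \<and> set_mset m \<subseteq> A}"
  using finite_multisets_of_size[of A d] by (simp add: multisets_of_size_def conj_commute)

lemma form_eq:
  assumes "finite A" "Poly_Mapping.keys v \<subseteq> A"
  shows "form d c v = (\<Sum>m | size m = d \<and> set_mset m \<subseteq> A.
                         c m * (\<Prod>i\<in>#m. Poly_Mapping.lookup v i))"
  unfolding form_def
proof (rule sum.mono_neutral_left)
  show "finite {m. size m = d \<and> set_mset m \<subseteq> A}"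
    by (rule finite_monomials[OF assms(1)])
  show "\<forall>m\<in>{m. size m = d \<and> set_mset m \<subseteq> A} - {m. size m = d \<and> set_mset m \<subseteq> Poly_Mapping.keys v}.
          c m * (\<Prod>i\<in>#m. Poly_Mapping.lookup v i) = 0"
    by (force simp: in_keys_iff)
qed (use assms in auto)

lemma monomials_independent:
  fixes c :: "'j \<Rightarrow> 'a::field" and mon :: "'j \<Rightarrow> nat multiset"
  assumes inf: "infinite (UNIV :: 'a set)"
    and "finite A" "finite T" "inj_on mon T" "\<forall>j\<in>T. set_mset (mon j) \<subseteq> A"
    and "\<And>x. (\<Sum>j\<in>T. c j * (\<Prod>i\<in>#mon j. x i)) = 0"
  shows "\<forall>j\<in>T. c j = 0"
  using assms(2-)
proof (induction A arbitrary: T mon rule: finite_induct)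
  case empty
  have "(\<Sum>j\<in>T. c j) = 0"
    using empty.prems(4)[of "\<lambda>_. 0"] empty.prems(3) by (simp cong: sum.cong)
  moreover have "T \<subseteq> {j}" if "j \<in> T" for j
    using that empty.prems(2,3) by (auto simp: inj_on_def)
  ultimately show ?case
    by (metis finite.emptyI empty_iff insert_absorb subset_singletonD sum.empty sum.insert
        add.right_neutral)
next
  case (insert a A)
  define rest where "rest j = filter_mset (\<lambda>i. i \<noteq> a) (mon j)" for j
  have mon_eq: "mon j = replicate_mset (count (mon j) a) a + rest j" for j
    unfolding rest_def by (rule multiset_eqI) auto
  show ?case
  proof
    fix j assume j: "j \<in> T"
    define k where "k = count (mon j) a"
    define Tk where "Tk = {j \<in> T. count (mon j) a = k}"
    have "\<forall>j\<in>Tk. c j = 0"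
    proof (rule insert.IH[where mon = rest])
      show "finite Tk"
        using insert.prems(1) by (simp add: Tk_def)
      show "inj_on rest Tk"
      proof (rule inj_onI)
        fix u v assume "u \<in> Tk" "v \<in> Tk" "rest u = rest v"
        moreover from this have "mon u = mon v"
          using mon_eq[of u] mon_eq[of v] by (simp add: Tk_def)
        ultimately show "u = v"
          using insert.prems(2) by (auto simp: Tk_def inj_on_def)
      qed
      show "\<forall>j\<in>Tk. set_mset (rest j) \<subseteq> A"
        using insert.prems(3) by (auto simp: Tk_def rest_def)
      fix x :: "nat \<Rightarrow> 'a"
      define p where "p = (\<Sum>j\<in>T. monom (c j * (\<Prod>i\<in>#rest j. x i)) (count (mon j) a))"
      have "poly p t = 0" for t
      proof -
        have "(\<Prod>i\<in>#mon j. (x(a := t)) i) = t ^ count (mon j) a * (\<Prod>i\<in>#rest j. x i)" for j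
        proof -
          have "image_mset (x(a := t)) (rest j) = image_mset x (rest j)"
            by (rule image_mset_cong) (auto simp: rest_def)
          thus ?thesis
            by (subst mon_eq) simp
        qed
        thus ?thesis
          using insert.prems(4)[of "x(a := t)"]
          by (simp add: p_def poly_sum poly_monom mult_ac)
      qed
      hence "p = 0"
        using poly_roots_finite[of p] inf by auto
      hence "0 = coeff p k" by simp
      also have "\<dots> = (\<Sum>j\<in>T. if count (mon j) a = k then c j * (\<Prod>i\<in>#rest j. x i) else 0)"
        by (simp add: p_def coeff_sum)
      also have "\<dots> = (\<Sum>j\<in>Tk. c j * (\<Prod>i\<in>#rest j. x i))"
        unfolding Tk_def using insert.prems(1) by (simp add: sum.inter_filter)
      finally show "(\<Sum>j\<in>Tk. c j * (\<Prod>i\<in>#rest j. x i)) = 0" by simp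
    qed
    thus "c j = 0"
      using j by (simp add: Tk_def k_def)
  qed
qed

lemma form_coeff_unique:
  fixes c c' :: "nat multiset \<Rightarrow> 'a::alg_closed_field"
  assumes eq: "form d c = form d c'" and m: "size m = d"
  shows "c m = c' m"
proof -
  define T where "T = {n. size n = d \<and> set_mset n \<subseteq> set_mset m}"
  have "\<forall>n\<in>T. c n - c' n = 0"
  proof (rule monomials_independent[where A = "set_mset m" and mon = id])
    show "infinite (UNIV :: 'a set)" by (rule infinite_UNIV_alg_closed)
    show "finite T" unfolding T_def by (rule finite_monomials) simp
    show "\<forall>n\<in>T. set_mset (id n) \<subseteq> set_mset m" by (simp add: T_def)
    fix x :: "nat \<Rightarrow> 'a"
    define v where "v = (\<Sum>i\<in>set_mset m. Poly_Mapping.single i (x i))"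
    have lk: "Poly_Mapping.lookup v i = (if i \<in># m then x i else 0)" for i
      by (simp add: v_def lookup_sum lookup_single when_def)
    have "Poly_Mapping.keys v \<subseteq> set_mset m"
      by (auto simp: in_keys_iff lk split: if_splits)
    hence F: "form d e v = (\<Sum>n\<in>T. e n * (\<Prod>i\<in>#n. Poly_Mapping.lookup v i))" for e
      unfolding T_def by (intro form_eq) auto
    have "(\<Prod>i\<in>#n. Poly_Mapping.lookup v i) = (\<Prod>i\<in>#n. x i)" if "n \<in> T" for n
      using that by (intro arg_cong[where f = prod_mset] image_mset_cong) (auto simp: T_def lk)
    hence "form d e v = (\<Sum>n\<in>T. e n * (\<Prod>i\<in>#n. x i))" for e
      unfolding F by (intro sum.cong) auto
    thus "(\<Sum>n\<in>T. (c n - c' n) * (\<Prod>i\<in>#id n. x i)) = 0"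
      using eq by (simp add: left_diff_distrib sum_subtractf) metis
  qed simp_all
  moreover have "m \<in> T" using m by (simp add: T_def)
  ultimately show ?thesis by simp
qed

lemma coeff_of_form:
  fixes c :: "nat multiset \<Rightarrow> 'a::alg_closed_field"
  shows "coeff_of d (form d c) m = (if size m = d then c m else 0)"
proof -
  define e where "e m = (if size m = d then c m else 0)" for m
  have "form d e = form d c"
    by (auto simp: form_def e_def fun_eq_iff intro!: sum.cong)
  hence "coeff_of d (form d c) = e"
    unfolding coeff_of_def
  proof (intro the_equality conjI)
    fix b assume b: "(\<forall>m. size m \<noteq> d \<longrightarrow> b m = 0) \<and> form d b = form d c"
    show "b = e"
    proof
      show "b n = e n" for n
        using b form_coeff_unique[of d b c n] by (auto simp: e_def)
    qed
  qed (auto simp: e_def)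
  thus ?thesis by (simp add: e_def)
qed

text \<open>The infimum of the empty set is \<open>\<infinity>\<close>.\<close>

definition q_rank :: "('a::field kinf \<Rightarrow> 'a) \<Rightarrow> enat" where
  "q_rank f = Inf {enat r | r. \<exists>l q. (\<forall>i<r. l i \<in> homog_poly 1 \<and> q i \<in> homog_poly 2) \<and>
                                     f = (\<lambda>v. \<Sum>i<r. l i v * q i v)}"

text \<open>
  The left action sends \<open>f\<close> to \<open>f\<close> composed with the inverse of \<open>g\<close>; the stable sets are the same.
\<close>

definition GL_stable :: "('a::field kinf \<Rightarrow> 'a) set \<Rightarrow> bool" where
  "GL_stable X \<longleftrightarrow> (\<forall>f\<in>X. \<forall>g\<in>GL_inf. f \<circ> g \<in> X)"

text \<open>
  Coordinate functions on \<open>homog_poly d\<close> are indexed by monomials of degree \<open>d\<close>, that is by multisets of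
  size \<open>d\<close>; a polynomial in the coordinate functions is a finitely supported family of
  coefficients indexed by multisets of such multisets. The ring \<open>coord_ring d\<close> is the symmetric
  algebra of the \<open>d\<close>-th symmetric power of the countable-dimensional space, and \<open>zariski d\<close> is the
  topology on the rational points of its spectrum.
\<close>

definition coord_ring :: "nat \<Rightarrow> (nat multiset multiset \<Rightarrow>\<^sub>0 'a::field) set" where
  "coord_ring d = {\<Phi>. \<forall>M\<in>Poly_Mapping.keys \<Phi>. \<forall>m\<in>#M. size m = d}"

definition coord_eval ::
  "nat \<Rightarrow> (nat multiset multiset \<Rightarrow>\<^sub>0 'a::field) \<Rightarrow> ('a kinf \<Rightarrow> 'a) \<Rightarrow> 'a" where
  "coord_eval d \<Phi> f =
     (\<Sum>M\<in>Poly_Mapping.keys \<Phi>. Poly_Mapping.lookup \<Phi> M * (\<Prod>m\<in>#M. coeff_of d f m))"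

definition zero_locus ::
  "nat \<Rightarrow> (nat multiset multiset \<Rightarrow>\<^sub>0 'a::field) set \<Rightarrow> ('a kinf \<Rightarrow> 'a) set" where
  "zero_locus d F = {f \<in> homog_poly d. \<forall>\<Phi>\<in>F. coord_eval d \<Phi> f = 0}"

definition zariski :: "nat \<Rightarrow> ('a::field kinf \<Rightarrow> 'a) topology" where
  "zariski d = topology (\<lambda>U. U \<subseteq> homog_poly d \<and> (\<exists>F \<subseteq> coord_ring d. homog_poly d - U = zero_locus d F))"

lemma coord_eval_superset:
  assumes "finite B" "Poly_Mapping.keys \<Phi> \<subseteq> B"
  shows "coord_eval d \<Phi> f = (\<Sum>M\<in>B. Poly_Mapping.lookup \<Phi> M * (\<Prod>m\<in>#M. coeff_of d f m))"
  unfolding coord_eval_def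
  by (rule sum.mono_neutral_left) (use assms in \<open>auto simp: in_keys_iff\<close>)

lemma coord_eval_add: "coord_eval d (\<Phi> + \<Psi>) f = coord_eval d \<Phi> f + coord_eval d \<Psi> f"
proof -
  let ?B = "Poly_Mapping.keys \<Phi> \<union> Poly_Mapping.keys \<Psi>"
  show ?thesis
    using coord_eval_superset[of ?B \<Phi>] coord_eval_superset[of ?B \<Psi>]
      coord_eval_superset[of ?B "\<Phi> + \<Psi>"] Poly_Mapping.keys_add[of \<Phi> \<Psi>]
    by (simp add: lookup_add distrib_right sum.distrib)
qed

lemma coord_eval_zero [simp]: "coord_eval d 0 f = 0"
  by (simp add: coord_eval_def)

lemma coord_eval_single:
  "coord_eval d (Poly_Mapping.single M a) f = a * (\<Prod>m\<in>#M. coeff_of d f m)"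
  by (subst coord_eval_superset[of "{M}"]) (auto simp: coord_eval_superset[of "{M}"])

lemma coord_eval_mult: "coord_eval d (\<Phi> * \<Psi>) f = coord_eval d \<Phi> f * coord_eval d \<Psi> f"
proof -
  have upd: "Poly_Mapping.update k b \<Theta> = \<Theta> + Poly_Mapping.single k b"
    if "k \<notin> Poly_Mapping.keys \<Theta>" for k b and \<Theta> :: "nat multiset multiset \<Rightarrow>\<^sub>0 'a"
    using that by (intro poly_mapping_eqI)
      (auto simp: lookup_update lookup_add lookup_single when_def in_keys_iff)
  have single: "coord_eval d (Poly_Mapping.single M a * \<Psi>) f =
      coord_eval d (Poly_Mapping.single M a) f * coord_eval d \<Psi> f" for M a
    by (induction \<Psi> rule: update_induct)
      (auto simp: upd distrib_left coord_eval_add coord_eval_single mult_single mult_ac)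
  show ?thesis
    by (induction \<Phi> rule: update_induct)
      (auto simp: upd distrib_right coord_eval_add single)
qed

lemma coord_ring_mult:
  "\<Phi> \<in> coord_ring d \<Longrightarrow> \<Psi> \<in> coord_ring d \<Longrightarrow> \<Phi> * \<Psi> \<in> coord_ring d"
  using keys_mult[of \<Phi> \<Psi>] by (fastforce simp: coord_ring_def)

lemma istopology_zariski:
  "istopology (\<lambda>U :: ('a::field kinf \<Rightarrow> 'a) set.
     U \<subseteq> homog_poly d \<and> (\<exists>F \<subseteq> coord_ring d. homog_poly d - U = zero_locus d F))"
  unfolding istopology_def
proof (intro conjI allI impI)
  fix U V :: "('a kinf \<Rightarrow> 'a) set"
  assume "U \<subseteq> homog_poly d \<and> (\<exists>F \<subseteq> coord_ring d. homog_poly d - U = zero_locus d F)"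
    and "V \<subseteq> homog_poly d \<and> (\<exists>F \<subseteq> coord_ring d. homog_poly d - V = zero_locus d F)"
  then obtain F G where FG: "U \<subseteq> homog_poly d" "F \<subseteq> coord_ring d" "homog_poly d - U = zero_locus d F"
      "G \<subseteq> coord_ring d" "homog_poly d - V = zero_locus d G"
    by blast
  let ?H = "{\<Phi> * \<Psi> | \<Phi> \<Psi>. \<Phi> \<in> F \<and> \<Psi> \<in> G}"
  have "zero_locus d ?H = zero_locus d F \<union> zero_locus d G"
    by (fastforce simp: zero_locus_def coord_eval_mult)
  hence "homog_poly d - U \<inter> V = zero_locus d ?H"
    using FG by blast
  moreover have "?H \<subseteq> coord_ring d"
    using FG by (auto intro: coord_ring_mult)
  ultimately show "\<exists>F \<subseteq> coord_ring d. homog_poly d - U \<inter> V = zero_locus d F"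
    by blast
  show "U \<inter> V \<subseteq> homog_poly d" using FG by blast
next
  fix K :: "('a kinf \<Rightarrow> 'a) set set"
  assume K: "\<forall>U\<in>K. U \<subseteq> homog_poly d \<and> (\<exists>F \<subseteq> coord_ring d. homog_poly d - U = zero_locus d F)"
  then obtain F where F: "\<And>U. U \<in> K \<Longrightarrow> F U \<subseteq> coord_ring d \<and> homog_poly d - U = zero_locus d (F U)"
    by metis
  have "homog_poly d - \<Union>K = homog_poly d \<inter> (\<Inter>U\<in>K. zero_locus d (F U))"
    using F by blast
  also have "\<dots> = zero_locus d (\<Union>U\<in>K. F U)"
    by (auto simp: zero_locus_def)
  finally show "\<exists>F \<subseteq> coord_ring d. homog_poly d - \<Union>K = zero_locus d F"
    using F by (intro exI[of _ "\<Union>U\<in>K. F U"]) blast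
  show "\<Union>K \<subseteq> homog_poly d" using K by blast
qed

lemma openin_zariski:
  "openin (zariski d) U \<longleftrightarrow> U \<subseteq> homog_poly d \<and> (\<exists>F \<subseteq> coord_ring d. homog_poly d - U = zero_locus d F)"
  unfolding zariski_def by (simp add: topology_inverse'[OF istopology_zariski])

lemma topspace_zariski [simp]: "topspace (zariski d) = (homog_poly d :: ('a::field kinf \<Rightarrow> 'a) set)"
proof
  show "topspace (zariski d) \<subseteq> (homog_poly d :: ('a kinf \<Rightarrow> 'a) set)"
    using openin_zariski[of d "topspace (zariski d) :: ('a kinf \<Rightarrow> 'a) set"] by simp
  let ?one = "1 :: nat multiset multiset \<Rightarrow>\<^sub>0 'a"
  have "?one \<in> coord_ring d" "coord_eval d ?one f = 1" for f :: "'a kinf \<Rightarrow> 'a"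
    using coord_eval_single[of d 0 1 f] by (simp_all add: coord_ring_def)
  hence "homog_poly d - homog_poly d = zero_locus d {?one}" "{?one} \<subseteq> coord_ring d"
    by (simp_all add: zero_locus_def)
  thus "(homog_poly d :: ('a kinf \<Rightarrow> 'a) set) \<subseteq> topspace (zariski d)"
    by (intro openin_subset) (metis openin_zariski subset_refl)
qed

end

theory Submission
  imports Defs "Jordan_Normal_Form.Determinant"
begin

text \<open>
  A polynomial \<open>\<Phi>\<close> in the coefficients of a cubic involves finitely many monomials, all in the
  first \<open>n\<close> variables, say. The closure of \<open>X\<close> is everything as soon as every \<open>\<Phi>\<close> that vanishes
  on \<open>X\<close> is zero as a function. Take \<open>f \<in> X\<close> of large q-rank and let \<open>T\<close> be its symmetric
  trilinear form, so that \<open>f x = T x x x\<close>. Composing \<open>f\<close> with a linear map that sends the first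
  basis vectors to \<open>u\<^sub>0, \<dots>, u\<^bsub>n-1\<^esub>\<close> gives a cubic whose coefficients in the first \<open>n\<close> variables
  are the numbers \<open>T u\<^sub>i u\<^sub>j u\<^sub>k\<close>, multiplied by \<open>1\<close>, \<open>3\<close> or \<open>6\<close>. So the question is whether these numbers can be moved
  freely.

  They can be moved freely to first order at \<open>v\<^sub>0, \<dots>, v\<^bsub>n-1\<^esub>\<close> if the linear functionals
  \<open>T v\<^sub>i v\<^sub>j _\<close> with \<open>i \<le> j\<close> are linearly independent, for then there are dual vectors \<open>w\<^bsub>ij\<^esub>\<close>,
  and adding combinations of these to the \<open>v\<^sub>i\<close> changes the numbers \<open>T v\<^sub>i v\<^sub>j v\<^sub>k\<close> in any
  prescribed direction. Since \<open>\<Phi>\<close> vanishes along the resulting curves, the part of lowest degree in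
  its expansion at the point \<open>(T v\<^sub>i v\<^sub>j v\<^sub>k)\<close> vanishes in every direction, which is absurd unless
  \<open>\<Phi>\<close> vanishes everywhere (\<open>zero_of_zero_on_curves\<close>). The curves can be chosen inside the orbit of \<open>f\<close> by
  adding a multiple of a fresh basis vector to each \<open>u\<^sub>i\<close>; if the multiple is of second order,
  this does not disturb the first order (\<open>linear_extension_in_GL_inf\<close>).

  It remains to find the \<open>v\<^sub>i\<close> (\<open>dual_system_of_high_q_rank\<close>). Let \<open>r\<close> be the greatest
  number of functionals \<open>T v\<^sub>i v\<^sub>j _\<close> that can be made independent by a choice of \<open>v\<close>, and suppose
  that some pair \<open>(k, l)\<close> is left over. Replace \<open>v\<^sub>i\<close> by \<open>v\<^sub>i + t a\<^sub>i x\<close>, where the \<open>a\<^sub>i\<close> are scalars.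
  By maximality the chosen functionals and the one of \<open>(k, l)\<close> stay dependent for all \<open>t\<close>, so
  there is a dependence with coefficients that are power series in \<open>t\<close>. Its term of degree \<open>2\<close>,
  evaluated at \<open>x\<close>, expresses \<open>\<kappa> f x\<close> as a sum of \<open>2 r\<close> products of a linear and a
  quadratic form in \<open>x\<close>, where \<open>\<kappa>\<close> is the value at \<open>a\<close> of a nonzero quadratic form that
  does not depend on \<open>x\<close>. Choosing \<open>a\<close> with \<open>\<kappa> \<noteq> 0\<close> bounds the q-rank of \<open>f\<close> by \<open>2 r\<close>
  (\<open>q_rank_le_of_maximal_dual_system\<close>).
\<close>

section \<open>Forms as values of multilinear forms\<close>

lemma finite_fibre_union:
  assumes "\<And>m. finite {j. ms j = m}" and "finite A"
  shows "finite {j. size (ms j) = d \<and> set_mset (ms j) \<subseteq> A}"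
proof -
  have "{j. size (ms j) = d \<and> set_mset (ms j) \<subseteq> A}
      = (\<Union>m\<in>{m. size m = d \<and> set_mset m \<subseteq> A}. {j. ms j = m})" by auto
  thus ?thesis using finite_monomials[OF assms(2), of d] assms(1) by simp
qed

text \<open>
  A sum over tuples of indices becomes a form by collecting the tuples with the same underlying
  monomial. This turns multilinear forms into elements of \<open>homog_poly d\<close>.
\<close>

lemma form_collect:
  fixes ms :: "'j \<Rightarrow> nat multiset" and b :: "'j \<Rightarrow> 'a::field"
  assumes d: "\<And>j. size (ms j) = d" and fin: "\<And>m. finite {j. ms j = m}"
  shows "form d (\<lambda>m. \<Sum>j | ms j = m. b j) v
       = (\<Sum>j | set_mset (ms j) \<subseteq> Poly_Mapping.keys v. b j * (\<Prod>i\<in>#ms j. Poly_Mapping.lookup v i))"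
proof -
  let ?K = "Poly_Mapping.keys v"
  let ?S = "{j. set_mset (ms j) \<subseteq> ?K}" and ?T = "{m. size m = d \<and> set_mset m \<subseteq> ?K}"
  let ?h = "\<lambda>j. b j * (\<Prod>i\<in>#ms j. Poly_Mapping.lookup v i)"
  have "finite ?S"
    using finite_fibre_union[OF fin, where A = ?K and d = d] by (simp add: d)
  moreover have "finite ?T" by (rule finite_monomials) simp
  moreover have "ms ` ?S \<subseteq> ?T" using d by auto
  ultimately have "(\<Sum>j\<in>?S. ?h j) = (\<Sum>m\<in>?T. \<Sum>j | j \<in> ?S \<and> ms j = m. ?h j)"
    by (rule sum.group[symmetric])
  also have "\<dots> = (\<Sum>m\<in>?T. (\<Sum>j | ms j = m. b j) * (\<Prod>i\<in>#m. Poly_Mapping.lookup v i))"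
  proof (rule sum.cong[OF refl])
    fix m assume "m \<in> ?T"
    hence "{j. j \<in> ?S \<and> ms j = m} = {j. ms j = m}" by auto
    thus "(\<Sum>j | j \<in> ?S \<and> ms j = m. ?h j)
        = (\<Sum>j | ms j = m. b j) * (\<Prod>i\<in>#m. Poly_Mapping.lookup v i)"
      by (simp add: sum_distrib_right)
  qed
  finally show ?thesis by (simp add: form_def)
qed

definition lin :: "(nat \<Rightarrow> 'a::field) \<Rightarrow> 'a kinf \<Rightarrow> 'a" where
  "lin l x = (\<Sum>i\<in>Poly_Mapping.keys x. l i * Poly_Mapping.lookup x i)"

definition bilin :: "(nat \<Rightarrow> nat \<Rightarrow> 'a::field) \<Rightarrow> 'a kinf \<Rightarrow> 'a kinf \<Rightarrow> 'a" where
  "bilin b x y = lin (\<lambda>i. lin (b i) y) x"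

definition trilin :: "(nat \<Rightarrow> nat \<Rightarrow> nat \<Rightarrow> 'a::field) \<Rightarrow> 'a kinf \<Rightarrow> 'a kinf \<Rightarrow> 'a kinf \<Rightarrow> 'a" where
  "trilin b x y z = lin (\<lambda>i. bilin (b i) y z) x"

lemma lin_superset:
  assumes "finite A" "Poly_Mapping.keys x \<subseteq> A"
  shows "lin l x = (\<Sum>i\<in>A. l i * Poly_Mapping.lookup x i)"
  unfolding lin_def by (rule sum.mono_neutral_left) (use assms in \<open>auto simp: in_keys_iff\<close>)

lemma lin_add: "lin l (x + y) = lin l x + lin l y"
proof -
  let ?A = "Poly_Mapping.keys x \<union> Poly_Mapping.keys y"
  show ?thesis
    using lin_superset[of ?A x] lin_superset[of ?A y] lin_superset[of ?A "x + y"]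
      Poly_Mapping.keys_add[of x y]
    by (simp add: lookup_add distrib_left sum.distrib)
qed

lemma lin_kscale: "lin l (kscale a x) = a * lin l x"
proof -
  have "Poly_Mapping.keys (kscale a x) \<subseteq> Poly_Mapping.keys x" by (auto simp: in_keys_iff)
  thus ?thesis
    using lin_superset[of "Poly_Mapping.keys x" "kscale a x"]
    by (simp add: lin_def sum_distrib_left mult_ac)
qed

lemma lin_coeff_add: "lin (\<lambda>i. l i + l' i) x = lin l x + lin l' x"
  by (simp add: lin_def distrib_right sum.distrib)

lemma lin_coeff_mult: "lin (\<lambda>i. a * l i) x = a * lin l x"
  by (simp add: lin_def sum_distrib_left mult_ac)

lemma lin_zero [simp]: "lin l 0 = 0" by (simp add: lin_def)

lemma lin_coeff_zero [simp]: "lin (\<lambda>i. 0) x = 0" by (simp add: lin_def)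

lemma lin_swap: "lin (\<lambda>i. lin (\<lambda>j. b i j) y) x = lin (\<lambda>j. lin (\<lambda>i. b i j) x) y"
  unfolding lin_def sum_distrib_right
  by (subst sum.swap) (simp add: mult_ac)

lemma lin_single [simp]: "lin l (Poly_Mapping.single i a) = l i * a"
  by (subst lin_superset[of "{i}"]) auto

lemma bilin_add1: "bilin b (x + x') y = bilin b x y + bilin b x' y"
  and bilin_add2: "bilin b x (y + y') = bilin b x y + bilin b x y'"
  and bilin_kscale1: "bilin b (kscale a x) y = a * bilin b x y"
  and bilin_kscale2: "bilin b x (kscale a y) = a * bilin b x y"
  by (simp_all add: bilin_def lin_add lin_kscale lin_coeff_add lin_coeff_mult)

lemma trilin_add1: "trilin b (x + x') y z = trilin b x y z + trilin b x' y z"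
  and trilin_add2: "trilin b x (y + y') z = trilin b x y z + trilin b x y' z"
  and trilin_add3: "trilin b x y (z + z') = trilin b x y z + trilin b x y z'"
  and trilin_kscale1: "trilin b (kscale a x) y z = a * trilin b x y z"
  and trilin_kscale2: "trilin b x (kscale a y) z = a * trilin b x y z"
  and trilin_kscale3: "trilin b x y (kscale a z) = a * trilin b x y z"
  by (simp_all add: trilin_def lin_add lin_kscale lin_coeff_add lin_coeff_mult
      bilin_add1 bilin_add2 bilin_kscale1 bilin_kscale2)

lemma trilin_zero [simp]: "trilin b 0 y z = 0" "trilin b x 0 z = 0" "trilin b x y 0 = 0"
  by (simp_all add: trilin_def bilin_def)

lemma trilin_sum1: "trilin b (\<Sum>i\<in>A. x i) y z = (\<Sum>i\<in>A. trilin b (x i) y z)"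
  and trilin_sum2: "trilin b y (\<Sum>i\<in>A. x i) z = (\<Sum>i\<in>A. trilin b y (x i) z)"
  and trilin_sum3: "trilin b y z (\<Sum>i\<in>A. x i) = (\<Sum>i\<in>A. trilin b y z (x i))"
  by (induction A rule: infinite_finite_induct; simp add: trilin_add1 trilin_add2 trilin_add3)+

lemmas trilin_simps = trilin_add1 trilin_add2 trilin_add3 trilin_kscale1 trilin_kscale2 trilin_kscale3

lemma lin_cong: "(\<And>i. l i = l' i) \<Longrightarrow> lin l x = lin l' x"
  by (simp add: lin_def)

lemma trilin_swap12:
  assumes "\<And>i j k. b i j k = b j i k"
  shows "trilin b x y z = trilin b y x z"
proof -
  have "trilin b x y z = lin (\<lambda>j. lin (\<lambda>i. lin (b i j) z) x) y"
    unfolding trilin_def bilin_def by (rule lin_swap)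
  also have "\<dots> = trilin b y x z"
    unfolding trilin_def bilin_def by (intro lin_cong) (rule assms)
  finally show ?thesis .
qed

lemma trilin_swap23:
  assumes "\<And>i j k. b i j k = b i k j"
  shows "trilin b x y z = trilin b x z y"
proof -
  have "bilin (b i) y z = bilin (b i) z y" for i
  proof -
    have "bilin (b i) y z = lin (\<lambda>k. lin (\<lambda>j. b i j k) y) z"
      unfolding bilin_def by (rule lin_swap)
    also have "\<dots> = bilin (b i) z y"
      unfolding bilin_def by (intro lin_cong) (rule assms)
    finally show ?thesis .
  qed
  thus ?thesis unfolding trilin_def by (intro lin_cong)
qed

lemma lin_homog: "lin l \<in> homog_poly 1"
proof -
  have "lin l = form 1 (\<lambda>m. \<Sum>j | {#j#} = m. l j)"
  proof
    fix v
    have "finite {j. {#j#} = m}" for m :: "nat multiset"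
      by (rule finite_subset[of _ "set_mset m"]) auto
    thus "lin l v = form 1 (\<lambda>m. \<Sum>j | {#j#} = m. l j) v"
      by (subst form_collect) (auto simp: lin_def)
  qed
  thus ?thesis unfolding homog_poly_def by blast
qed

lemma bilin_homog:
  fixes b :: "nat \<Rightarrow> nat \<Rightarrow> 'a::field"
  shows "(\<lambda>x. bilin b x x) \<in> homog_poly 2"
proof -
  define ms :: "nat \<times> nat \<Rightarrow> nat multiset" where "ms = (\<lambda>(i, j). {#i, j#})"
  have "(\<lambda>x. bilin b x x) = form 2 (\<lambda>m. \<Sum>j | ms j = m. case_prod b j)"
  proof
    fix v :: "'a kinf"
    let ?K = "Poly_Mapping.keys v"
    have "finite {j. ms j = m}" for m
      by (rule finite_subset[of _ "set_mset m \<times> set_mset m"]) (auto simp: ms_def)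
    hence "form 2 (\<lambda>m. \<Sum>j | ms j = m. case_prod b j) v = (\<Sum>j | set_mset (ms j) \<subseteq> ?K.
        case_prod b j * (\<Prod>i\<in>#ms j. Poly_Mapping.lookup v i))"
      by (intro form_collect) (auto simp: ms_def)
    also have "{j. set_mset (ms j) \<subseteq> ?K} = ?K \<times> ?K" by (auto simp: ms_def)
    also have "(\<Sum>j\<in>?K \<times> ?K. case_prod b j * (\<Prod>i\<in>#ms j. Poly_Mapping.lookup v i)) = bilin b v v"
      by (simp add: bilin_def lin_def sum.cartesian_product sum_distrib_left sum_distrib_right
          ms_def mult_ac split_def)
    finally show "bilin b v v = form 2 (\<lambda>m. \<Sum>j | ms j = m. case_prod b j) v" ..
  qed
  thus ?thesis unfolding homog_poly_def by blast
qed

definition triples :: "nat multiset \<Rightarrow> (nat \<times> nat \<times> nat) set" where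
  "triples m = {(i, j, k). {#i, j, k#} = m}"

lemma finite_triples [simp]: "finite (triples m)"
  by (rule finite_subset[of _ "set_mset m \<times> set_mset m \<times> set_mset m"]) (auto simp: triples_def)

lemma trilin_form:
  fixes b :: "nat \<Rightarrow> nat \<Rightarrow> nat \<Rightarrow> 'a::field"
  shows "(\<lambda>x. trilin b x x x) = form 3 (\<lambda>m. \<Sum>(i, j, k)\<in>triples m. b i j k)"
proof
  fix v :: "'a kinf"
  define ms :: "nat \<times> nat \<times> nat \<Rightarrow> nat multiset" where "ms = (\<lambda>(i, j, k). {#i, j, k#})"
  define c where "c = (\<lambda>(i, j, k). b i j k)"
  let ?K = "Poly_Mapping.keys v"
  have tr: "triples m = {j. ms j = m}" for m by (auto simp: triples_def ms_def)
  have "form 3 (\<lambda>m. \<Sum>(i, j, k)\<in>triples m. b i j k) v = (\<Sum>j | set_mset (ms j) \<subseteq> ?K.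
      c j * (\<Prod>i\<in>#ms j. Poly_Mapping.lookup v i))"
    unfolding tr c_def[symmetric]
    by (rule form_collect) (auto simp: tr[symmetric], simp add: ms_def split_def)
  also have "{j. set_mset (ms j) \<subseteq> ?K} = ?K \<times> ?K \<times> ?K" by (auto simp: ms_def)
  also have "(\<Sum>j\<in>?K \<times> ?K \<times> ?K. c j * (\<Prod>i\<in>#ms j. Poly_Mapping.lookup v i)) = trilin b v v v"
    by (simp add: trilin_def bilin_def lin_def sum.cartesian_product sum_distrib_left sum_distrib_right
        ms_def c_def mult_ac split_def)
  finally show "trilin b v v v = form 3 (\<lambda>m. \<Sum>(i, j, k)\<in>triples m. b i j k) v" ..
qed

lemma triples_eq:
  "triples {#a, b, c#} = {(a,b,c), (a,c,b), (b,a,c), (b,c,a), (c,a,b), (c,b,a)}"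
  by (auto simp: triples_def add_eq_conv_ex)

lemma size_3_multiset:
  assumes "size m = 3"
  obtains a b c where "m = {#a, b, c#}"
proof -
  have "size m = Suc (Suc (Suc 0))" using assms by simp
  then obtain a N where N: "m = add_mset a N" "size N = Suc (Suc 0)"
    by (metis size_eq_Suc_imp_eq_union size_add_mset nat.inject)
  then obtain b N' where N': "N = add_mset b N'" "size N' = Suc 0"
    by (metis size_eq_Suc_imp_eq_union size_add_mset nat.inject)
  then obtain c where "N' = {#c#}"
    by (metis One_nat_def size_1_singleton_mset)
  thus ?thesis using N N' that by simp
qed

lemma two_three_nonzero:
  assumes "CHAR('a::field) \<noteq> 2" "CHAR('a) \<noteq> 3"
  shows "(2 :: 'a) \<noteq> 0" "(3 :: 'a) \<noteq> 0"
proof -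
  have p: "(of_nat p :: 'a) \<noteq> 0" if "prime p" "CHAR('a) \<noteq> p" for p
    using that CHAR_not_1'[where 'a='a] by (auto simp: of_nat_eq_0_iff_char_dvd prime_nat_iff)
  show "(2 :: 'a) \<noteq> 0" using p[of 2] assms by simp
  show "(3 :: 'a) \<noteq> 0" using p[of 3] assms by simp
qed

text \<open>
  The multinomial coefficient of a cubic monomial is \<open>1\<close>, \<open>3\<close> or \<open>6\<close>. The restriction on the
  characteristic enters through this lemma and through the division by \<open>3\<close> in
  \<open>coord_eval_zero_of_orbit_zero\<close>.
\<close>

lemma card_triples_nonzero:
  assumes "CHAR('a::field) \<noteq> 2" "CHAR('a) \<noteq> 3" and "size m = 3"
  shows "(of_nat (card (triples m)) :: 'a) \<noteq> 0"
proof -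
  have "(6 :: 'a) = 2 * 3" by simp
  hence "(6 :: 'a) \<noteq> 0" using two_three_nonzero[OF assms(1,2)] by (metis mult_eq_0_iff)
  moreover obtain a b c where m: "m = {#a, b, c#}" using size_3_multiset[OF assms(3)] .
  moreover have "card (triples m) \<in> {1, 3, 6}"
    unfolding m triples_eq by (cases "a = b"; cases "b = c"; cases "a = c") (auto simp: card_insert_if)
  ultimately show ?thesis using two_three_nonzero(2)[OF assms(1,2)] by auto
qed

locale symmetric_trilinear =
  fixes b :: "nat \<Rightarrow> nat \<Rightarrow> nat \<Rightarrow> 'a::field"
  assumes sym12: "b i j k = b j i k" and sym23: "b i j k = b i k j"

text \<open>
  Each coefficient is shared evenly among the ordered triples of indices that give its monomial,
  which makes the trilinear form symmetric.
\<close>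

lemma cubic_polarisation:
  fixes f :: "'a::field kinf \<Rightarrow> 'a"
  assumes "CHAR('a) \<noteq> 2" "CHAR('a) \<noteq> 3" and "f \<in> homog_poly 3"
  obtains b where "symmetric_trilinear b" "f = (\<lambda>x. trilin b x x x)"
proof -
  obtain c where c: "f = form 3 c" using assms(3) by (auto simp: homog_poly_def)
  define b where "b i j k = c {#i, j, k#} / of_nat (card (triples {#i, j, k#}))" for i j k
  have "(\<Sum>(i, j, k)\<in>triples m. b i j k) = c m" if "size m = 3" for m
  proof -
    have "(\<Sum>(i, j, k)\<in>triples m. b i j k) = (\<Sum>t\<in>triples m. c m / of_nat (card (triples m)))"
      by (rule sum.cong) (auto simp: b_def triples_def)
    thus ?thesis using card_triples_nonzero[OF assms(1,2) that] by simp
  qed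
  hence "form 3 (\<lambda>m. \<Sum>(i, j, k)\<in>triples m. b i j k) = f"
    unfolding c form_def by (intro ext sum.cong) auto
  hence "f = (\<lambda>x. trilin b x x x)" by (simp add: trilin_form)
  moreover have "symmetric_trilinear b"
    by unfold_locales (simp_all add: b_def add_mset_commute)
  ultimately show ?thesis by (intro that)
qed

lemma coeff_of_trilin:
  fixes b :: "nat \<Rightarrow> nat \<Rightarrow> nat \<Rightarrow> 'a::alg_closed_field"
  assumes "\<And>i j k. b i j k = b j i k" "\<And>i j k. b i j k = b i k j"
  shows "coeff_of 3 (\<lambda>x. trilin b x x x) {#i, j, k#} = of_nat (card (triples {#i, j, k#})) * b i j k"
proof -
  have "(\<Sum>(i', j', k')\<in>triples {#i, j, k#}. b i' j' k') = (\<Sum>t\<in>triples {#i, j, k#}. b i j k)"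
  proof (rule sum.cong[OF refl])
    have "b i k j = b i j k" "b j i k = b i j k" "b j k i = b i j k"
      "b k i j = b i j k" "b k j i = b i j k"
      using assms by metis+
    thus "(case t of (i', j', k') \<Rightarrow> b i' j' k') = b i j k" if "t \<in> triples {#i, j, k#}" for t
      using that by (auto simp: triples_eq)
  qed
  thus ?thesis by (simp add: trilin_form coeff_of_form)
qed

lemma homog_add:
  assumes "f \<in> homog_poly d" "g \<in> homog_poly d"
  shows "(\<lambda>x. f x + g x) \<in> homog_poly d"
proof -
  obtain c c' where "f = form d c" "g = form d c'" using assms by (auto simp: homog_poly_def)
  hence "(\<lambda>x. f x + g x) = form d (\<lambda>m. c m + c' m)"
    by (intro ext) (simp add: form_def distrib_right sum.distrib)
  thus ?thesis by (simp add: homog_poly_def)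
qed

lemma homog_scale:
  assumes "f \<in> homog_poly d"
  shows "(\<lambda>x. a * f x) \<in> homog_poly d"
proof -
  obtain c where "f = form d c" using assms by (auto simp: homog_poly_def)
  hence "(\<lambda>x. a * f x) = form d (\<lambda>m. a * c m)"
    by (intro ext) (simp add: form_def sum_distrib_left mult_ac)
  thus ?thesis by (simp add: homog_poly_def)
qed

lemma homog_diff:
  assumes "f \<in> homog_poly d" "g \<in> homog_poly d"
  shows "(\<lambda>x. f x - g x) \<in> homog_poly d"
  using homog_add[OF assms(1) homog_scale[OF assms(2), of "-1"]] by simp

lemma homog_sum:
  assumes "\<And>j. j \<in> J \<Longrightarrow> f j \<in> homog_poly d"
  shows "(\<lambda>x. \<Sum>j\<in>J. f j x) \<in> homog_poly d"
proof -
  have zero: "(\<lambda>x. 0) \<in> homog_poly d"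
    unfolding homog_poly_def by (rule range_eqI[of _ _ "\<lambda>m. 0"]) (simp add: form_def fun_eq_iff)
  show ?thesis using assms
  proof (induction J rule: infinite_finite_induct)
    case (insert j J)
    thus ?case using homog_add[of "f j" d "\<lambda>x. \<Sum>j\<in>J. f j x"] by simp
  qed (simp_all add: zero)
qed

lemma homog_1_eq_lin:
  assumes "f \<in> homog_poly 1"
  obtains l where "f = lin l"
proof -
  obtain c where c: "f = form 1 c" using assms by (auto simp: homog_poly_def)
  have "f = lin (\<lambda>i. c {#i#})"
  proof
    fix v :: "'a kinf"
    have "{m. size m = 1 \<and> set_mset m \<subseteq> Poly_Mapping.keys v} = (\<lambda>i. {#i#}) ` Poly_Mapping.keys v"
      by (auto dest!: size_1_singleton_mset[unfolded One_nat_def])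
    thus "f v = lin (\<lambda>i. c {#i#}) v"
      by (simp add: c form_def lin_def sum.reindex inj_on_def)
  qed
  thus ?thesis by (rule that)
qed

lemma homog_1_mult:
  assumes "f \<in> homog_poly 1" "g \<in> homog_poly 1"
  shows "(\<lambda>x. f x * g x) \<in> homog_poly 2"
proof -
  obtain l l' where "f = lin l" "g = lin l'" using assms homog_1_eq_lin by metis
  hence "(\<lambda>x. f x * g x) = (\<lambda>x. bilin (\<lambda>i j. l i * l' j) x x)"
    by (simp add: bilin_def lin_coeff_mult) (simp add: lin_def sum_distrib_left mult_ac)
  thus ?thesis by (simp add: bilin_homog)
qed

lemma q_rank_le:
  assumes "finite J" "\<And>j. j \<in> J \<Longrightarrow> l j \<in> homog_poly 1" "\<And>j. j \<in> J \<Longrightarrow> q j \<in> homog_poly 2"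
    and "\<And>v. f v = (\<Sum>j\<in>J. l j v * q j v)"
  shows "q_rank f \<le> enat (card J)"
proof -
  obtain e where e: "bij_betw e {..<card J} J"
    using ex_bij_betw_nat_finite[OF assms(1)] by (auto simp: atLeast0LessThan)
  have "f = (\<lambda>v. \<Sum>i<card J. l (e i) v * q (e i) v)"
    using assms(4) sum.reindex_bij_betw[OF e, of "\<lambda>j. l j _ * q j _"] by (intro ext) simp
  moreover have "\<forall>i<card J. l (e i) \<in> homog_poly 1 \<and> q (e i) \<in> homog_poly 2"
    using assms(2,3) bij_betwE[OF e] by auto
  ultimately show ?thesis
    unfolding q_rank_def
    by (intro Inf_lower CollectI exI[of _ "card J"] conjI exI[of _ "\<lambda>i. l (e i)"]
        exI[of _ "\<lambda>i. q (e i)"]) auto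
qed

section \<open>Singular matrices of polynomials\<close>

text \<open>
  Dividing a polynomial relation by the variable as often as possible makes it nontrivial at \<open>0\<close>.
  The process stops because the degree of the nonzero entry \<open>\<alpha> p0\<close> decreases.
\<close>

lemma primitive_kernel_vector:
  fixes \<alpha> :: "nat \<Rightarrow> 'a::field poly"
  assumes "\<And>q. q \<le> r \<Longrightarrow> (\<Sum>p\<le>r. \<alpha> p * P p q) = 0" and "p0 \<le> r" "\<alpha> p0 \<noteq> 0"
  obtains \<beta> p1 where "\<And>q. q \<le> r \<Longrightarrow> (\<Sum>p\<le>r. \<beta> p * P p q) = 0"
    "p1 \<le> r" "coeff (\<beta> p1) 0 \<noteq> 0"
proof -
  have "\<exists>\<beta>. (\<forall>q\<le>r. (\<Sum>p\<le>r. \<beta> p * P p q) = 0) \<and> (\<exists>p\<le>r. coeff (\<beta> p) 0 \<noteq> 0)"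
    using assms(1,3)
  proof (induction "degree (\<alpha> p0)" arbitrary: \<alpha> rule: less_induct)
    case less
    show ?case
    proof (cases "\<exists>p\<le>r. coeff (\<alpha> p) 0 \<noteq> 0")
      case True
      thus ?thesis using less.prems by blast
    next
      case False
      have "\<forall>p. \<exists>b. \<alpha> p = pCons (coeff (\<alpha> p) 0) b"
        by (metis coeff_pCons_0 pCons_cases)
      then obtain \<gamma> where "\<And>p. \<alpha> p = pCons (coeff (\<alpha> p) 0) (\<gamma> p)" by metis
      hence \<gamma>: "\<alpha> p = [:0, 1:] * \<gamma> p" if "p \<le> r" for p
        using False that by (metis mult_pCons_left smult_0_left add_0 mult_1 smult_1_left
            one_pCons)
      have "(\<Sum>p\<le>r. \<gamma> p * P p q) = 0" if "q \<le> r" for q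
      proof -
        have "[:0, 1:] * (\<Sum>p\<le>r. \<gamma> p * P p q) = (\<Sum>p\<le>r. \<alpha> p * P p q)"
          unfolding sum_distrib_left by (rule sum.cong) (simp_all only: \<gamma> mult_ac atMost_iff)
        thus ?thesis using less.prems(1)[OF that] by simp
      qed
      moreover have "\<gamma> p0 \<noteq> 0" using \<gamma>[OF assms(2)] less.prems(2) by auto
      moreover have "degree (\<gamma> p0) < degree (\<alpha> p0)"
        using \<gamma>[OF assms(2)] \<open>\<gamma> p0 \<noteq> 0\<close> by simp
      ultimately show ?thesis using less.hyps by blast
    qed
  qed
  thus ?thesis using that by blast
qed

lemma dual_of_nonsingular:
  fixes A :: "nat \<Rightarrow> nat \<Rightarrow> 'a::field"
  assumes "det (mat n n (\<lambda>(i, j). A i j)) \<noteq> 0"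
  obtains B where "\<And>i j. i < n \<Longrightarrow> j < n \<Longrightarrow> (\<Sum>k<n. A i k * B k j) = (if i = j then 1 else 0)"
proof -
  let ?A = "mat n n (\<lambda>(i, j). A i j)"
  have "?A \<in> Units (ring_mat TYPE('a) n ())"
    by (rule det_non_zero_imp_unit) (use assms in auto)
  then obtain C where C: "C \<in> carrier_mat n n" "?A * C = 1\<^sub>m n"
    by (auto simp: Units_def ring_mat_def)
  have "(\<Sum>k<n. A i k * C $$ (k, j)) = (if i = j then 1 else 0)" if "i < n" "j < n" for i j
  proof -
    have "(?A * C) $$ (i, j) = (\<Sum>k<n. A i k * C $$ (k, j))"
      using that C(1) by (simp add: scalar_prod_def atLeast0LessThan)
    thus ?thesis using that C(2) by simp
  qed
  thus ?thesis by (intro that[of "\<lambda>k j. C $$ (k, j)"])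
qed

text \<open>
  The determinant is a polynomial with infinitely many roots, hence zero, and over the domain of
  polynomials a singular matrix has a kernel vector.
\<close>

lemma kernel_of_pointwise_singular:
  fixes P :: "nat \<Rightarrow> nat \<Rightarrow> 'a::field poly"
  assumes "infinite (UNIV :: 'a set)"
    and "\<And>t. det (mat n n (\<lambda>(p, q). poly (P p q) t)) = 0"
  obtains \<alpha> p0 where "\<And>q. q < n \<Longrightarrow> (\<Sum>p<n. \<alpha> p * P p q) = 0" "p0 < n" "\<alpha> p0 \<noteq> 0"
proof -
  let ?M = "mat n n (\<lambda>(p, q). P p q)"
  have "poly (det ?M) t = 0" for t
  proof -
    interpret comm_ring_hom "\<lambda>p. poly p t" by unfold_locales auto
    have "map_mat (\<lambda>p. poly p t) ?M = mat n n (\<lambda>(p, q). poly (P p q) t)"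
      by (rule eq_matI) auto
    thus ?thesis using hom_det[of ?M] assms(2)[of t] by simp
  qed
  hence "det ?M = 0" using poly_roots_finite[of "det ?M"] assms(1) by auto
  hence "det (transpose_mat ?M) = 0" by (subst det_transpose) auto
  then obtain v where v: "v \<in> carrier_vec n" "v \<noteq> 0\<^sub>v n" "transpose_mat ?M *\<^sub>v v = 0\<^sub>v n"
    using det_0_iff_vec_prod_zero[of "transpose_mat ?M" n] by auto
  have "(\<Sum>p<n. v $ p * P p q) = 0" if "q < n" for q
  proof -
    have "(transpose_mat ?M *\<^sub>v v) $ q = (\<Sum>p<n. v $ p * P p q)"
      using that v(1) by (simp add: scalar_prod_def atLeast0LessThan mult.commute)
    thus ?thesis using v(3) that by simp
  qed
  moreover obtain p0 where "p0 < n" "v $ p0 \<noteq> 0"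
    using v(1,2) by (metis carrier_vecD eq_vecI index_zero_vec)
  ultimately show ?thesis by (intro that[of "\<lambda>p. v $ p"])
qed

text \<open>
  Rows \<open>0, \<dots>, r - 1\<close> are functionals depending on a parameter \<open>t\<close>, evaluated at vectors
  \<open>0, \<dots>, r - 1\<close> to which they are dual for \<open>t = 0\<close>, and at a further vector \<open>r\<close>. The last row is a
  functional whose dependence on the others persists near \<open>t = 0\<close>. Subtracting its value at \<open>t = 0\<close>, as a combination of
  the other rows with constant coefficients, leaves a row \<open>g\<close> that vanishes at \<open>t = 0\<close>. The
  coefficients that express \<open>g\<close> by the other rows can be read off from the first \<open>r\<close> columns as
  power series in \<open>t\<close>, and the last column gives the formula by comparing coefficients of \<open>t\<^sup>2\<close>.
  In every product the degrees in \<open>t\<close> add up to \<open>2\<close>, which later makes it a linear form times a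
  quadratic form.
\<close>

lemma singular_matrix_second_order:
  fixes P :: "nat \<Rightarrow> nat \<Rightarrow> 'a::field poly"
  assumes inf: "infinite (UNIV :: 'a set)"
    and sing: "\<And>t. det (mat (Suc r) (Suc r) (\<lambda>(p, q). poly (P p q) t)) = 0"
    and unit: "\<And>p q. p < r \<Longrightarrow> q < r \<Longrightarrow> coeff (P p q) 0 = (if p = q then 1 else 0)"
  defines "g \<equiv> \<lambda>d q. coeff (P r q) d - (\<Sum>p<r. coeff (P r p) 0 * coeff (P p q) d)"
  shows "g 2 r = (\<Sum>q<r. coeff (P q r) 0 * (g 2 q - (\<Sum>p<r. g 1 p * coeff (P p q) 1)))
               + (\<Sum>p<r. g 1 p * coeff (P p r) 1)"
proof -
  obtain \<alpha>' p0' where "\<And>q. q \<le> r \<Longrightarrow> (\<Sum>p\<le>r. \<alpha>' p * P p q) = 0" "p0' \<le> r" "\<alpha>' p0' \<noteq> 0"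
    using kernel_of_pointwise_singular[OF inf sing] by (metis less_Suc_eq_le lessThan_Suc_atMost)
  then obtain \<alpha> p1 where \<alpha>: "\<And>q. q \<le> r \<Longrightarrow> (\<Sum>p\<le>r. \<alpha> p * P p q) = 0"
    and p1: "p1 \<le> r" "coeff (\<alpha> p1) 0 \<noteq> 0"
    using primitive_kernel_vector[of r \<alpha>' P p0'] by metis
  define \<beta> where "\<beta> = \<alpha> r"
  define c where "c p = coeff (P r p) 0" for p
  define \<gamma> where "\<gamma> p = \<alpha> p + Polynomial.smult (c p) \<beta>" for p
  define G where "G q = P r q - (\<Sum>p<r. Polynomial.smult (c p) (P p q))" for q
  have G: "coeff (G q) d = g d q" for q d
    by (simp add: G_def g_def c_def coeff_sum)
  have rel: "(\<Sum>p<r. \<gamma> p * P p q) + \<beta> * G q = 0" if "q \<le> r" for q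
  proof -
    have "(\<Sum>p\<le>r. \<alpha> p * P p q) = (\<Sum>p<r. \<alpha> p * P p q) + \<beta> * P r q"
      by (simp add: lessThan_Suc_atMost[symmetric] \<beta>_def)
    moreover have "(\<Sum>p<r. \<gamma> p * P p q) = (\<Sum>p<r. \<alpha> p * P p q) + \<beta> * (\<Sum>p<r. Polynomial.smult (c p) (P p q))"
      by (simp add: \<gamma>_def distrib_right sum.distrib sum_distrib_left)
    ultimately show ?thesis using \<alpha>[OF that] by (simp add: G_def algebra_simps)
  qed
  let ?e = "coeff \<beta>"
  let ?k = "\<lambda>d p. coeff (\<gamma> p) d" and ?h = "\<lambda>d p q. coeff (P p q) d"
  have c0: "coeff (x * y) 0 = coeff x 0 * coeff y 0"
    and c1: "coeff (x * y) 1 = coeff x 0 * coeff y 1 + coeff x 1 * coeff y 0"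
    and c2: "coeff (x * y) 2 = coeff x 0 * coeff y 2 + coeff x 1 * coeff y 1 + coeff x 2 * coeff y 0"
    for x y :: "'a poly"
    by (simp_all add: coeff_mult numeral_2_eq_2)
  have R: "(\<Sum>p<r. coeff (\<gamma> p * P p q) d) + coeff (\<beta> * G q) d = 0" if "q \<le> r" for q d
    using arg_cong[OF rel[OF that], of "\<lambda>x. coeff x d"] by (simp add: coeff_sum)
  have delta: "(\<Sum>p<r. x p * ?h 0 p q) = x q" if "q < r" for q x
  proof -
    have "(\<Sum>p<r. x p * ?h 0 p q) = (\<Sum>p<r. if p = q then x p else 0)"
      by (rule sum.cong) (use that unit in auto)
    thus ?thesis using that by simp
  qed
  have g0: "g 0 q = 0" if "q < r" for q
    using that by (simp add: g_def delta)
  have k0: "?k 0 q = 0" if "q < r" for q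
    using R[of q 0] that g0[OF that] by (simp add: c0 G delta)
  \<comment> \<open>The relation is nontrivial at \<open>0\<close>, where the first \<open>r\<close> rows are independent.\<close>
  have e0: "?e 0 \<noteq> 0"
  proof
    assume "?e 0 = 0"
    moreover from this have "coeff (\<alpha> p) 0 = 0" if "p < r" for p
      using k0[OF that] by (simp add: \<gamma>_def)
    ultimately show False using p1 by (cases "p1 = r") (auto simp: \<beta>_def)
  qed
  have g0r: "g 0 r = 0"
    using R[of r 0] e0 k0 by (simp add: c0 G)
  have k1: "?k 1 q = - ?e 0 * g 1 q" if "q < r" for q
    using R[of q 1] that g0[OF that] k0 unfolding c1 G
    by (simp add: delta eq_neg_iff_add_eq_0)
  have K1: "(\<Sum>p<r. ?k 1 p * F p) = - ?e 0 * (\<Sum>p<r. g 1 p * F p)" for F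
    unfolding sum_distrib_left by (rule sum.cong) (simp_all add: k1 mult_ac del: One_nat_def)
  have "(\<Sum>p<r. ?k 1 p * ?h 0 p r) + ?e 0 * g 1 r = 0"
    using R[of r 1] g0r k0 unfolding c1 G by simp
  hence "?e 0 * (g 1 r - (\<Sum>p<r. g 1 p * ?h 0 p r)) = 0"
    unfolding K1 by (simp add: algebra_simps)
  hence g1r: "g 1 r = (\<Sum>p<r. g 1 p * ?h 0 p r)" using e0 by simp
  have k2: "?k 2 q = ?e 0 * (\<Sum>p<r. g 1 p * ?h 1 p q) - ?e 0 * g 2 q - ?e 1 * g 1 q" if "q < r" for q
  proof -
    have "(\<Sum>p<r. ?k 1 p * ?h 1 p q + ?k 2 p * ?h 0 p q) + (?e 0 * g 2 q + ?e 1 * g 1 q) = 0"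
      using R[of q 2] that g0[OF that] k0 unfolding c2 G by simp
    hence "?k 2 q + ?e 0 * g 2 q + ?e 1 * g 1 q - ?e 0 * (\<Sum>p<r. g 1 p * ?h 1 p q) = 0"
      unfolding sum.distrib K1 delta[OF that] by (simp add: algebra_simps)
    thus ?thesis by (simp add: algebra_simps)
  qed
  have "(\<Sum>p<r. ?k 1 p * ?h 1 p r) + (\<Sum>p<r. ?k 2 p * ?h 0 p r) + (?e 0 * g 2 r + ?e 1 * g 1 r) = 0"
    using R[of r 2] g0r k0 unfolding c2 G by (simp add: sum.distrib)
  moreover have "(\<Sum>p<r. ?k 2 p * ?h 0 p r)
      = - ?e 0 * (\<Sum>q<r. ?h 0 q r * (g 2 q - (\<Sum>p<r. g 1 p * ?h 1 p q))) - ?e 1 * (\<Sum>p<r. g 1 p * ?h 0 p r)"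
    unfolding sum_distrib_left[of "- ?e 0"] sum_distrib_left[of "?e 1"] sum_subtractf[symmetric]
    by (rule sum.cong) (simp_all add: k2 algebra_simps)
  ultimately have "?e 0 * (g 2 r - ((\<Sum>q<r. ?h 0 q r * (g 2 q - (\<Sum>p<r. g 1 p * ?h 1 p q)))
      + (\<Sum>p<r. g 1 p * ?h 1 p r))) = 0"
    unfolding K1 g1r by (simp add: algebra_simps)
  thus ?thesis using e0 by simp
qed

section \<open>Dual systems for a cubic of high q-rank\<close>

context symmetric_trilinear
begin

abbreviation T :: "'a kinf \<Rightarrow> 'a kinf \<Rightarrow> 'a kinf \<Rightarrow> 'a" where "T \<equiv> trilin b"

lemma T12: "T x y z = T y x z" by (rule trilin_swap12) (rule sym12)
lemma T23: "T x y z = T x z y" by (rule trilin_swap23) (rule sym23)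

lemma T_linear: "(\<lambda>x. T x y z) \<in> homog_poly 1" "(\<lambda>x. T y x z) \<in> homog_poly 1"
  "(\<lambda>x. T y z x) \<in> homog_poly 1"
proof -
  show 1: "(\<lambda>x. T x y z) \<in> homog_poly 1" for y z by (simp only: trilin_def lin_homog)
  show 2: "(\<lambda>x. T y x z) \<in> homog_poly 1" for y z by (subst T12) (rule 1)
  show "(\<lambda>x. T y z x) \<in> homog_poly 1" by (subst T23) (rule 2)
qed

lemma T_quadratic: "(\<lambda>x. T x x z) \<in> homog_poly 2" "(\<lambda>x. T x z x) \<in> homog_poly 2"
  "(\<lambda>x. T z x x) \<in> homog_poly 2"
proof -
  have eq: "(\<lambda>x. T x x z) = (\<lambda>x. bilin (\<lambda>i j. lin (b i j) z) x x)" for z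
    by (simp add: trilin_def bilin_def)
  show 1: "(\<lambda>x. T x x z) \<in> homog_poly 2" for z unfolding eq by (rule bilin_homog)
  show 2: "(\<lambda>x. T x z x) \<in> homog_poly 2" by (subst T23) (rule 1)
  show "(\<lambda>x. T z x x) \<in> homog_poly 2" by (subst T12, subst T23) (rule 1)
qed

end

text \<open>
  The pair \<open>e r\<close> contributes a monomial with coefficient \<open>1\<close> that cannot be cancelled, because
  distinct pairs in increasing order give distinct monomials.
\<close>

lemma quadratic_nonvanishing:
  fixes c :: "nat \<Rightarrow> 'a::field" and e :: "nat \<Rightarrow> nat \<times> nat"
  assumes inf: "infinite (UNIV :: 'a set)"
    and inj: "inj_on e {..r}" and le: "\<And>p. p \<le> r \<Longrightarrow> fst (e p) \<le> snd (e p)"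
  obtains a :: "nat \<Rightarrow> 'a"
  where "a (fst (e r)) * a (snd (e r)) - (\<Sum>p<r. c p * (a (fst (e p)) * a (snd (e p)))) \<noteq> 0"
proof -
  define ms where "ms p = {#fst (e p), snd (e p)#}" for p
  define c' where "c' p = (if p = r then 1 else - c p)" for p
  have "inj_on ms {..r}"
  proof (rule inj_onI)
    fix p q assume pq: "p \<in> {..r}" "q \<in> {..r}" "ms p = ms q"
    have "fst (e p) = fst (e q) \<and> snd (e p) = snd (e q)"
      using pq(3) le[of p] le[of q] pq(1,2) by (auto simp: ms_def add_eq_conv_ex)
    thus "p = q" using inj pq(1,2) by (auto simp: inj_on_def prod_eq_iff)
  qed
  have "\<exists>a. (\<Sum>p\<le>r. c' p * (\<Prod>i\<in>#ms p. a i)) \<noteq> 0"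
  proof (rule ccontr)
    assume "\<not> ?thesis"
    hence "\<forall>p\<in>{..r}. c' p = 0"
      by (intro monomials_independent[OF inf, where A = "\<Union>p\<le>r. set_mset (ms p)" and mon = ms])
        (use \<open>inj_on ms {..r}\<close> in auto)
    thus False by (auto simp: c'_def dest: bspec[of _ _ r])
  qed
  then obtain a where "(\<Sum>p\<le>r. c' p * (\<Prod>i\<in>#ms p. a i)) \<noteq> 0" ..
  moreover have "(\<Sum>p\<le>r. c' p * (\<Prod>i\<in>#ms p. a i))
      = a (fst (e r)) * a (snd (e r)) - (\<Sum>p<r. c p * (a (fst (e p)) * a (snd (e p))))"
    by (simp add: lessThan_Suc_atMost[symmetric] c'_def ms_def sum_negf)
  ultimately show ?thesis using that by simp
qed

context symmetric_trilinear
begin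

text \<open>
  The sequence \<open>e\<close> lists \<open>r\<close> pairs of indices. That dual vectors \<open>z\<close> exist expresses that the
  functionals of these pairs are linearly independent, without reference to the dual space.
\<close>

definition dual_system :: "nat \<Rightarrow> (nat \<Rightarrow> nat \<times> nat) \<Rightarrow> (nat \<Rightarrow> 'a kinf) \<Rightarrow> (nat \<Rightarrow> 'a kinf) \<Rightarrow> bool" where
  "dual_system r e v z \<longleftrightarrow>
     (\<forall>p<r. \<forall>q<r. T (v (fst (e p))) (v (snd (e p))) (z q) = (if p = q then 1 else 0))"

lemma dual_system_of_nonsingular:
  assumes "det (mat r r (\<lambda>(p, q). T (v (fst (e p))) (v (snd (e p))) (z q))) \<noteq> 0"
  obtains z' where "dual_system r e v z'"
proof -
  obtain B where B: "\<And>p q. p < r \<Longrightarrow> q < r \<Longrightarrow>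
      (\<Sum>k<r. T (v (fst (e p))) (v (snd (e p))) (z k) * B k q) = (if p = q then 1 else 0)"
    using dual_of_nonsingular[OF assms] by metis
  have "dual_system r e v (\<lambda>q. \<Sum>k<r. kscale (B k q) (z k))"
    unfolding dual_system_def trilin_sum3 trilin_kscale3
    using B by (simp add: mult.commute)
  thus ?thesis by (rule that)
qed

text \<open>
  The functional of the pair \<open>e r\<close> remains in the span of the others under every perturbation
  \<open>v i + t a\<^sub>i x\<close> of the vectors, since otherwise a larger dual system would exist. In the
  second order formula the coefficient of degree \<open>2\<close> of the functional of a pair \<open>(i, j)\<close>, evaluated
  at \<open>x\<close>, is \<open>a\<^sub>i a\<^sub>j T x x x\<close>, so the left-hand side is a multiple of the cubic itself.
\<close>

lemma q_rank_le_of_maximal_dual_system: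
  assumes inf: "infinite (UNIV :: 'a set)"
    and inj: "inj_on e {..r}" and le: "\<And>p. p \<le> r \<Longrightarrow> fst (e p) \<le> snd (e p)"
    and dual: "dual_system r e v z"
    and maximal: "\<And>v z. \<not> dual_system (Suc r) e v z"
  shows "q_rank (\<lambda>x. T x x x) \<le> enat (2 * r)"
proof -
  define I J where "I p = fst (e p)" and "J p = snd (e p)" for p
  define c where "c p = T (v (I r)) (v (J r)) (z p)" for p
  obtain a where a: "a (I r) * a (J r) - (\<Sum>p<r. c p * (a (I p) * a (J p))) \<noteq> 0"
    unfolding I_def J_def using quadratic_nonvanishing[OF inf inj le] by metis
  define \<kappa> where "\<kappa> = a (I r) * a (J r) - (\<Sum>p<r. c p * (a (I p) * a (J p)))"
  \<comment> \<open>The coefficient of \<open>t ^ d\<close> of the perturbed functional of the pair \<open>e p\<close>, evaluated at \<open>y\<close>.\<close>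
  define h where "h d p y x = (if d = 0 then T (v (I p)) (v (J p)) y
      else if d = 1 then a (I p) * T x (v (J p)) y + a (J p) * T (v (I p)) x y
      else a (I p) * a (J p) * T x x y)" for d :: nat and p y x
  define g where "g d y x = h d r y x - (\<Sum>p<r. c p * h d p y x)" for d y x
  have key: "\<kappa> * T x x x = (\<Sum>q<r. T (v (I q)) (v (J q)) x *
        (g 2 (z q) x - (\<Sum>p<r. g 1 (z p) x * h 1 p (z q) x)))
      + (\<Sum>p<r. g 1 (z p) x * h 1 p x x)" for x
  proof -
    define y where "y q = (if q < r then z q else x)" for q
    define P where "P p q = [:h 0 p (y q) x, h 1 p (y q) x, h 2 p (y q) x:]" for p q
    have P: "coeff (P p q) d = h d p (y q) x" if "d \<in> {0, 1, 2}" for p q d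
      using that by (auto simp: P_def numeral_2_eq_2)
    have "poly (P p q) t = T (v (I p) + kscale (t * a (I p)) x) (v (J p) + kscale (t * a (J p)) x) (y q)"
      for p q t
      by (simp add: P_def h_def trilin_simps algebra_simps)
    hence sing: "det (mat (Suc r) (Suc r) (\<lambda>(p, q). poly (P p q) t)) = 0" for t
      using dual_system_of_nonsingular[of "Suc r" "\<lambda>i. v i + kscale (t * a i) x" e y] maximal
      by (auto simp: I_def J_def)
    have unit: "coeff (P p q) 0 = (if p = q then 1 else 0)" if "p < r" "q < r" for p q
      using dual that by (simp add: P h_def y_def dual_system_def I_def J_def)
    have c: "coeff (P r p) 0 = c p" if "p < r" for p
      using that by (simp add: P c_def h_def y_def)
    have g: "coeff (P r q) d - (\<Sum>p<r. coeff (P r p) 0 * coeff (P p q) d) = g d (y q) x"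
      if "d \<in> {0, 1, 2}" for q d
      using that by (simp add: g_def P[OF that] c)
    have coeffs: "coeff (P p q) 0 = h 0 p (y q) x" "coeff (P p q) 1 = h 1 p (y q) x"
      "coeff (P r q) 1 - (\<Sum>p<r. coeff (P r p) 0 * coeff (P p q) 1) = g 1 (y q) x"
      "coeff (P r q) 2 - (\<Sum>p<r. coeff (P r p) 0 * coeff (P p q) 2) = g 2 (y q) x" for p q
      by (rule P g; simp)+
    have "g 2 (y r) x = (\<Sum>q<r. h 0 q (y r) x *
        (g 2 (y q) x - (\<Sum>p<r. g 1 (y p) x * h 1 p (y q) x))) + (\<Sum>p<r. g 1 (y p) x * h 1 p (y r) x)"
      unfolding coeffs[symmetric] by (rule singular_matrix_second_order[OF inf sing unit])
    moreover have "g 2 (y r) x = \<kappa> * T x x x"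
      by (simp add: g_def h_def y_def \<kappa>_def algebra_simps sum_distrib_left sum_distrib_right)
    moreover have "y r = x" "\<And>q. q < r \<Longrightarrow> y q = z q" by (simp_all add: y_def)
    ultimately show ?thesis by (simp add: h_def[of 0] del: One_nat_def)
  qed
  have h1: "h 1 p y \<in> homog_poly 1" for p y
  proof -
    have "h 1 p y = (\<lambda>x. a (I p) * T x (v (J p)) y + a (J p) * T (v (I p)) x y)"
      by (simp add: h_def fun_eq_iff)
    thus ?thesis by (simp only: homog_add homog_scale T_linear)
  qed
  have h1x: "(\<lambda>x. h 1 p x x) \<in> homog_poly 2" for p
    unfolding h_def by (simp add: homog_add homog_scale T_quadratic)
  have h2: "h 2 p y \<in> homog_poly 2" for p y
    unfolding h_def by (simp add: homog_scale T_quadratic)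
  have g1: "g 1 y \<in> homog_poly 1" for y
    unfolding g_def by (intro homog_diff homog_sum homog_scale h1)
  have g2: "g 2 y \<in> homog_poly 2" for y
    unfolding g_def by (intro homog_diff homog_sum homog_scale h2)
  \<comment> \<open>Each pair contributes two products, told apart by \<open>s\<close>.\<close>
  define l where "l = (\<lambda>(p, s). if s then g 1 (z p) else T (v (I p)) (v (J p)))"
  define q where "q = (\<lambda>(p, s) x. inverse \<kappa> * (if s then h 1 p x x
      else g 2 (z p) x - (\<Sum>p'<r. g 1 (z p') x * h 1 p' (z p) x)))"
  have "q_rank (\<lambda>x. T x x x) \<le> enat (card ({..<r} \<times> (UNIV :: bool set)))"
  proof (rule q_rank_le)
    show "l j \<in> homog_poly 1" for j
      by (cases j; cases "snd j") (use g1 T_linear(3) in \<open>simp_all add: l_def\<close>)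
    have "(\<lambda>x. inverse \<kappa> * h 1 p x x) \<in> homog_poly 2" for p
      by (intro homog_scale h1x)
    moreover have "(\<lambda>x. inverse \<kappa> * (g 2 (z p) x - (\<Sum>p'<r. g 1 (z p') x * h 1 p' (z p) x)))
        \<in> homog_poly 2" for p
      by (intro homog_scale homog_diff homog_sum homog_1_mult g2 g1 h1)
    ultimately show "q j \<in> homog_poly 2" for j
      by (cases j; cases "snd j") (simp_all add: q_def)
    fix x
    have "T x x x = inverse \<kappa> * (\<kappa> * T x x x)"
      using a by (simp add: \<kappa>_def)
    also have "\<dots> = (\<Sum>p<r. \<Sum>s\<in>UNIV. l (p, s) x * q (p, s) x)"
      unfolding key by (simp add: UNIV_bool l_def q_def sum.distrib sum_distrib_left
          distrib_left mult_ac)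
    finally show "T x x x = (\<Sum>j\<in>{..<r} \<times> UNIV. l j x * q j x)"
      by (simp add: sum.cartesian_product)
  qed simp
  thus ?thesis by (simp add: mult.commute)
qed

text \<open>
  A dual system with the greatest possible number of pairs uses all pairs, since a missing one
  could play the part of \<open>e r\<close> in the preceding bound.
\<close>

lemma dual_system_of_high_q_rank:
  fixes n :: nat
  defines "S \<equiv> {(i, j). i \<le> j \<and> j < n}"
  assumes inf: "infinite (UNIV :: 'a set)"
    and q: "q_rank (\<lambda>x. T x x x) > enat (2 * card S)"
  obtains v w where "\<forall>(i, j)\<in>S. \<forall>p\<in>S. T (v i) (v j) (w p) = (if p = (i, j) then 1 else 0)"
proof -
  have "finite S"
    by (rule finite_subset[of _ "{..<n} \<times> {..<n}"]) (auto simp: S_def)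
  define ok where "ok r \<longleftrightarrow> (\<exists>e v z. inj_on e {..<r} \<and> e ` {..<r} \<subseteq> S \<and> dual_system r e v z)" for r
  have "ok 0" by (simp add: ok_def dual_system_def)
  have bound: "r \<le> card S" if ok: "ok r" for r
  proof -
    obtain e where "inj_on e {..<r}" "e ` {..<r} \<subseteq> S" using ok unfolding ok_def by blast
    from card_inj_on_le[OF this \<open>finite S\<close>] show ?thesis by simp
  qed
  define r where "r = (GREATEST r. ok r)"
  have "ok r"
    unfolding r_def using \<open>ok 0\<close> bound by (rule GreatestI_nat)
  have max: "\<not> ok (Suc r)"
    using Greatest_le_nat[of ok "Suc r" "card S"] bound by (auto simp: r_def)
  obtain e v z where e: "inj_on e {..<r}" "e ` {..<r} \<subseteq> S" "dual_system r e v z"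
    using \<open>ok r\<close> unfolding ok_def by blast
  have "e ` {..<r} = S"
  proof (rule ccontr)
    assume "e ` {..<r} \<noteq> S"
    then obtain s where s: "s \<in> S" "s \<notin> e ` {..<r}" using e(2) by blast
    define e' where "e' = e(r := s)"
    have img: "e' ` {..<r} = e ` {..<r}" by (auto simp: e'_def)
    have "inj_on e' {..<r}" using e(1) by (auto simp: e'_def inj_on_def)
    hence inj: "inj_on e' {..<Suc r}"
      using s(2) img by (simp add: lessThan_Suc e'_def)
    have sub: "e' ` {..<Suc r} \<subseteq> S"
      using s(1) e(2) by (auto simp: e'_def less_Suc_eq)
    have "dual_system r e' v z" using e(3) by (simp add: dual_system_def e'_def)
    moreover have "\<not> dual_system (Suc r) e' v z" for v z
      using max inj sub by (auto simp: ok_def)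
    moreover have "fst (e' p) \<le> snd (e' p)" if "p \<le> r" for p
      using sub that by (force simp: S_def image_subset_iff less_Suc_eq_le)
    ultimately have "q_rank (\<lambda>x. T x x x) \<le> enat (2 * r)"
      using inj by (intro q_rank_le_of_maximal_dual_system[OF inf, of e']) (auto simp: lessThan_Suc_atMost)
    also have "\<dots> \<le> enat (2 * card S)" using bound[OF \<open>ok r\<close>] by simp
    finally show False using q by simp
  qed
  hence bij: "bij_betw e {..<r} S" using e(1) by (simp add: bij_betw_def)
  define w where "w p = z (inv_into {..<r} e p)" for p
  have "T (v i) (v j) (w p) = (if p = (i, j) then 1 else 0)" if "(i, j) \<in> S" "p \<in> S" for i j p
  proof -
    have "(i, j) \<in> e ` {..<r}" "p \<in> e ` {..<r}" using that \<open>e ` {..<r} = S\<close> by simp_all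
    then obtain k k' where k: "k < r" "e k = (i, j)" "k' < r" "e k' = p" by auto
    have "w p = z k'" using k e(1) by (auto simp: w_def)
    moreover have "T (v i) (v j) (z k') = (if k = k' then 1 else 0)"
      using e(3)[unfolded dual_system_def, rule_format, OF k(1,3)] k(2) by simp
    moreover have "k = k' \<longleftrightarrow> p = (i, j)" using k e(1) by (auto simp: inj_on_def)
    ultimately show ?thesis by simp
  qed
  thus ?thesis by (intro that[of v w]) blast
qed

end

section \<open>Invertible linear maps with prescribed values\<close>

definition linear_extension :: "(nat \<Rightarrow> 'a::field kinf) \<Rightarrow> 'a kinf \<Rightarrow> 'a kinf" where
  "linear_extension G x = (\<Sum>i\<in>Poly_Mapping.keys x. kscale (Poly_Mapping.lookup x i) (G i))"

lemma lookup_linear_extension: "Poly_Mapping.lookup (linear_extension G x) j = lin (\<lambda>i. Poly_Mapping.lookup (G i) j) x"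
  by (simp add: linear_extension_def lin_def lookup_sum mult.commute)

lemma linear_extension_add: "linear_extension G (x + y) = linear_extension G x + linear_extension G y"
  by (rule poly_mapping_eqI) (simp add: lookup_linear_extension lookup_add lin_add)

lemma linear_extension_kscale: "linear_extension G (kscale a x) = kscale a (linear_extension G x)"
  by (rule poly_mapping_eqI) (simp add: lookup_linear_extension lin_kscale)

lemma linear_extension_single: "linear_extension G (Poly_Mapping.single i 1) = G i"
  by (rule poly_mapping_eqI) (simp add: lookup_linear_extension)

lemma linear_linear_extension: "Vector_Spaces.linear kscale kscale (linear_extension G)"
  unfolding Vector_Spaces.linear_iff
  by (simp add: vector_space_kscale linear_extension_add linear_extension_kscale)

lemma trilin_linear_extension: "trilin b (linear_extension G x) (linear_extension G y) (linear_extension G z)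
    = trilin (\<lambda>i j k. trilin b (G i) (G j) (G k)) x y z"
proof -
  have 1: "trilin b (linear_extension G x) y z = lin (\<lambda>i. trilin b (G i) y z) x"
    and 2: "trilin b y (linear_extension G x) z = lin (\<lambda>i. trilin b y (G i) z) x"
    and 3: "trilin b y z (linear_extension G x) = lin (\<lambda>i. trilin b y z (G i)) x" for x y z
    by (simp_all add: linear_extension_def lin_def trilin_sum1 trilin_sum2 trilin_sum3
        trilin_kscale1 trilin_kscale2 trilin_kscale3 mult.commute)
  have "trilin b (linear_extension G x) (linear_extension G y) (linear_extension G z)
      = lin (\<lambda>i. trilin b (G i) (linear_extension G y) (linear_extension G z)) x" by (rule 1)
  also have "\<dots> = lin (\<lambda>i. lin (\<lambda>j. trilin b (G i) (G j) (linear_extension G z)) y) x"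
    by (intro lin_cong) (rule 2)
  also have "\<dots> = lin (\<lambda>i. lin (\<lambda>j. lin (\<lambda>k. trilin b (G i) (G j) (G k)) z) y) x"
    by (intro lin_cong) (rule 3)
  finally show ?thesis
    unfolding trilin_def[of "\<lambda>i j k. trilin b (G i) (G j) (G k)"] bilin_def .
qed

lemma in_range_linear_extension:
  fixes G :: "nat \<Rightarrow> 'a::field kinf"
  assumes "\<And>j. j \<in> Poly_Mapping.keys y \<Longrightarrow> Poly_Mapping.single j 1 \<in> range (linear_extension G)"
  shows "y \<in> range (linear_extension G)"
proof -
  have "\<exists>x. linear_extension G x = Poly_Mapping.single j 1" if "j \<in> Poly_Mapping.keys y" for j
    using assms[OF that] by (auto simp: image_iff eq_commute)
  then obtain x where x: "\<And>j. j \<in> Poly_Mapping.keys y \<Longrightarrow> linear_extension G (x j) = Poly_Mapping.single j 1"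
    by metis
  have zero: "linear_extension G 0 = 0" by (simp add: linear_extension_def)
  have sum: "linear_extension G (\<Sum>j\<in>A. z j) = (\<Sum>j\<in>A. linear_extension G (z j))" for A and z :: "nat \<Rightarrow> 'a kinf"
    by (induction A rule: infinite_finite_induct) (simp_all add: linear_extension_add zero)
  have "linear_extension G (\<Sum>j\<in>Poly_Mapping.keys y. kscale (Poly_Mapping.lookup y j) (x j))
      = (\<Sum>j\<in>Poly_Mapping.keys y. kscale (Poly_Mapping.lookup y j) (Poly_Mapping.single j 1))"
    unfolding sum by (rule sum.cong) (simp_all add: linear_extension_kscale x)
  also have "\<dots> = y"
    by (rule poly_mapping_eqI)
      (simp add: lookup_sum lookup_single when_def if_distrib in_keys_iff cong: if_cong)
  finally show ?thesis by (rule range_eqI[OF sym])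
qed

text \<open>
  The basis vectors with indices from \<open>N\<close> to \<open>N + n - 1\<close> are fresh for the vectors \<open>u i\<close>. Adding a
  nonzero multiple of one of them to each \<open>u i\<close> makes these independent whatever they were, and
  sending the fresh vectors back to the first \<open>n\<close> basis vectors, which have been given up, completes
  the assignment to an automorphism.
\<close>

lemma linear_extension_in_GL_inf:
  fixes u :: "nat \<Rightarrow> 'a::field kinf"
  assumes N: "n \<le> N" "\<And>i. i < n \<Longrightarrow> Poly_Mapping.keys (u i) \<subseteq> {..<N}" and s: "s \<noteq> 0"
  defines "G \<equiv> \<lambda>i. if i < n then u i + Poly_Mapping.single (N + i) s
                   else if N \<le> i \<and> i < N + n then Poly_Mapping.single (i - N) 1
                   else Poly_Mapping.single i 1"
  shows "linear_extension G \<in> GL_inf"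
proof -
  have u0: "Poly_Mapping.lookup (u i) (N + j) = 0" if "i < n" for i j
    using N(2)[OF that] by (force simp: in_keys_iff)
  have lin_pick: "lin l x = a * Poly_Mapping.lookup x i"
    if "\<And>k. k \<in> Poly_Mapping.keys x \<Longrightarrow> l k = (if k = i then a else 0)" for l x a i
  proof -
    have "lin l x = (\<Sum>k\<in>Poly_Mapping.keys x. if k = i then a * Poly_Mapping.lookup x i else 0)"
      unfolding lin_def by (rule sum.cong) (simp_all add: that)
    thus ?thesis by (simp add: in_keys_iff)
  qed
  have ker: "x = 0" if "linear_extension G x = 0" for x
  proof -
    have z: "lin (\<lambda>i. Poly_Mapping.lookup (G i) j) x = 0" for j
      using lookup_linear_extension[of G x j] that by simp
    have "s * Poly_Mapping.lookup x i = 0" if "i < n" for i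
      using that N(1) by (subst lin_pick[symmetric, OF _ ])
        (auto simp: z[of "N + i", symmetric] G_def lookup_add lookup_single when_def u0)
    hence low: "i \<notin> Poly_Mapping.keys x" if "i < n" for i using that s by (simp add: in_keys_iff)
    have "1 * Poly_Mapping.lookup x i = 0" for i
    proof -
      consider "i < n" | "n \<le> i" "N \<le> i" "i < N + n" | "n \<le> i" "\<not> (N \<le> i \<and> i < N + n)" by linarith
      thus ?thesis
      proof cases
        case 1
        thus ?thesis using low by (simp add: in_keys_iff)
      next
        case 2
        have "lin (\<lambda>k. Poly_Mapping.lookup (G k) (i - N)) x = 1 * Poly_Mapping.lookup x i"
        proof (rule lin_pick)
          fix k assume "k \<in> Poly_Mapping.keys x"
          hence "\<not> k < n" using low by blast
          thus "Poly_Mapping.lookup (G k) (i - N) = (if k = i then 1 else 0)"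
            using 2 N(1) by (auto simp: G_def lookup_single when_def)
        qed
        thus ?thesis using z by simp
      next
        case 3
        have "lin (\<lambda>k. Poly_Mapping.lookup (G k) i) x = 1 * Poly_Mapping.lookup x i"
        proof (rule lin_pick)
          fix k assume "k \<in> Poly_Mapping.keys x"
          hence "\<not> k < n" using low by blast
          thus "Poly_Mapping.lookup (G k) i = (if k = i then 1 else 0)"
            using 3 N(1) by (auto simp: G_def lookup_single when_def)
        qed
        thus ?thesis using z by simp
      qed
    qed
    thus "x = 0" by (intro poly_mapping_eqI) simp
  qed
  have diff: "linear_extension G (x - y) = linear_extension G x - linear_extension G y" for x y
    by (metis add_diff_cancel_right' diff_add_cancel linear_extension_add)
  have "inj (linear_extension G)"
  proof (rule injI)
    fix x y assume "linear_extension G x = linear_extension G y"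
    hence "x - y = 0" using ker[of "x - y"] diff by simp
    thus "x = y" by simp
  qed
  moreover have "surj (linear_extension G)"
  proof -
    have low: "Poly_Mapping.single j 1 \<in> range (linear_extension G)" if "j < N" for j
    proof (cases "j < n")
      case True
      hence "G (N + j) = Poly_Mapping.single j 1" using N(1) by (simp add: G_def)
      thus ?thesis by (metis linear_extension_single rangeI)
    next
      case False
      hence "G j = Poly_Mapping.single j 1" using that by (simp add: G_def)
      thus ?thesis by (metis linear_extension_single rangeI)
    qed
    have single: "Poly_Mapping.single j 1 \<in> range (linear_extension G)" for j
    proof -
      consider "j < N" | "N + n \<le> j" | i where "i < n" "j = N + i"
        by (metis le_add_diff_inverse less_diff_conv2 add.commute not_le)
      thus ?thesis
      proof cases
        case 1
        thus ?thesis by (rule low)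
      next
        case 2
        hence "G j = Poly_Mapping.single j 1" by (simp add: G_def)
        thus ?thesis by (metis linear_extension_single rangeI)
      next
        case 3
        have "u i \<in> range (linear_extension G)"
        proof (rule in_range_linear_extension)
          fix l assume "l \<in> Poly_Mapping.keys (u i)"
          hence "l < N" using N(2)[OF 3(1)] by blast
          thus "Poly_Mapping.single l 1 \<in> range (linear_extension G)" by (rule low)
        qed
        then obtain y where y: "u i = linear_extension G y" by blast
        have "linear_extension G (kscale (inverse s) (Poly_Mapping.single i 1 - y)) = Poly_Mapping.single j 1"
          unfolding linear_extension_kscale diff linear_extension_single y[symmetric]
          using 3 s by (intro poly_mapping_eqI)
            (simp add: G_def lookup_add lookup_minus lookup_single when_def)
        thus ?thesis by (metis rangeI)
      qed
    qed
    have "y \<in> range (linear_extension G)" for y by (rule in_range_linear_extension) (rule single)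
    thus ?thesis by blast
  qed
  ultimately show ?thesis by (simp add: GL_inf_def linear_linear_extension bij_def)
qed

section \<open>Polynomials vanishing on the orbit\<close>

lemma poly_eq_0_infinite:
  fixes p :: "'a::field poly"
  assumes "infinite (UNIV :: 'a set)" and "\<And>t. t \<noteq> 0 \<Longrightarrow> poly p t = 0"
  shows "p = 0"
proof (rule ccontr)
  assume "p \<noteq> 0"
  have "UNIV \<subseteq> insert 0 {t. poly p t = 0}" using assms(2) by auto
  thus False using poly_roots_finite[OF \<open>p \<noteq> 0\<close>] assms(1) finite_subset by blast
qed

text \<open>
  A polynomial function that vanishes along curves through the point \<open>c\<close> in all directions \<open>Y\<close> is
  zero: its expansion at \<open>c\<close> would otherwise have a nonzero homogeneous part of lowest degree
  \<open>e\<close>, and along a curve with direction \<open>Y\<close> the coefficient of \<open>t ^ e\<close> is the value of that part at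
  \<open>Y\<close>. The expansion is obtained from a polynomial in two variables, by replacing \<open>c + t Z(t)\<close> with
  \<open>c + s Z(t)\<close>; its coefficient at \<open>s ^ e\<close> is the homogeneous part of degree \<open>e\<close> at \<open>Z(t)\<close>. The
  scalars \<open>\<mu>\<close> make room for the multinomial coefficients of the application.
\<close>

lemma zero_of_zero_on_curves:
  fixes \<Phi> :: "'m multiset \<Rightarrow>\<^sub>0 'a::field" and \<mu> :: "'m \<Rightarrow> 'a"
  defines "ev \<equiv> \<lambda>y. \<Sum>M\<in>Poly_Mapping.keys \<Phi>. Poly_Mapping.lookup \<Phi> M * (\<Prod>m\<in>#M. \<mu> m * y m)"
  assumes inf: "infinite (UNIV :: 'a set)"
    and curve: "\<And>Y. \<exists>P. (\<forall>m. coeff (P m) 0 = c m \<and> coeff (P m) 1 = Y m) \<and>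
                       (\<forall>t. t \<noteq> 0 \<longrightarrow> ev (\<lambda>m. poly (P m) t) = 0)"
  shows "ev y = 0"
proof (rule ccontr)
  assume y: "ev y \<noteq> 0"
  \<comment> \<open>The outer variable is \<open>s\<close>, the inner one \<open>t\<close>: \<open>Q Y\<close> stands for \<open>ev (c + s Y(t))\<close>.\<close>
  define Q :: "('m \<Rightarrow> 'a poly) \<Rightarrow> 'a poly poly" where
    "Q Y = (\<Sum>M\<in>Poly_Mapping.keys \<Phi>. [:[:Poly_Mapping.lookup \<Phi> M:]:] *
              (\<Prod>m\<in>#M. [:[:\<mu> m:]:] * [:[:c m:], Y m:]))" for Y
  have Q: "poly (poly (Q Y) [:s:]) t = ev (\<lambda>m. c m + s * poly (Y m) t)"
    and Q': "poly (poly (Q Y) [:0, 1:]) t = ev (\<lambda>m. c m + t * poly (Y m) t)" for Y s t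
  proof -
    have pm: "poly (prod_mset A) x = prod_mset (image_mset (\<lambda>p. poly p x) A)"
      for A :: "'b::comm_semiring_1 poly multiset" and x by (induction A) auto
    show "poly (poly (Q Y) [:s:]) t = ev (\<lambda>m. c m + s * poly (Y m) t)"
      "poly (poly (Q Y) [:0, 1:]) t = ev (\<lambda>m. c m + t * poly (Y m) t)"
      by (simp_all add: Q_def ev_def poly_sum pm image_mset.compositionality comp_def algebra_simps)
  qed
  \<comment> \<open>\<open>coeff (Q0 Y) e\<close> is the homogeneous part of degree \<open>e\<close> at \<open>Y\<close>, for constant directions.\<close>
  define Q0 :: "('m \<Rightarrow> 'a) \<Rightarrow> 'a poly" where "Q0 Y = map_poly (\<lambda>p. poly p 0) (Q (\<lambda>m. [:Y m:]))" for Y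
  have spec: "poly (coeff (Q Y) e) t = coeff (Q0 (\<lambda>m. poly (Y m) t)) e" for Y e t
  proof -
    have "poly (map_poly (\<lambda>p. poly p t) (Q Y)) s = poly (Q0 (\<lambda>m. poly (Y m) t)) s" for s
    proof -
      have *: "poly (map_poly (\<lambda>p. poly p u) p) s = poly (poly p [:s:]) u" for p u
        by (induction p) (auto simp: map_poly_pCons)
      show ?thesis unfolding Q0_def * Q by simp
    qed
    hence "map_poly (\<lambda>p. poly p t) (Q Y) = Q0 (\<lambda>m. poly (Y m) t)"
      using poly_eq_0_infinite[OF inf, of "map_poly (\<lambda>p. poly p t) (Q Y) - Q0 (\<lambda>m. poly (Y m) t)"] by simp
    thus ?thesis by (metis coeff_map_poly poly_0)
  qed
  have "poly (poly (Q (\<lambda>m. [:y m - c m:])) [:1:]) 0 \<noteq> 0"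
    unfolding Q using y by simp
  hence "Q (\<lambda>m. [:y m - c m:]) \<noteq> 0" by auto
  have "\<exists>e Y. coeff (Q0 Y) e \<noteq> 0"
  proof (rule ccontr)
    assume "\<not> ?thesis"
    hence "poly (coeff (Q (\<lambda>m. [:y m - c m:])) e) t = 0" for e t
      by (simp add: spec)
    hence "coeff (Q (\<lambda>m. [:y m - c m:])) e = 0" for e
      by (rule poly_eq_0_infinite[OF inf])
    thus False using \<open>Q _ \<noteq> 0\<close> by (simp add: poly_eq_iff)
  qed
  then obtain e where "\<exists>Y. coeff (Q0 Y) e \<noteq> 0"
    and least: "\<And>e' Y. e' < e \<Longrightarrow> coeff (Q0 Y) e' = 0"
    using exists_least_iff[of "\<lambda>e. \<exists>Y. coeff (Q0 Y) e \<noteq> 0"] by auto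
  then obtain Y where Y: "coeff (Q0 Y) e \<noteq> 0" by auto
  obtain P where P: "\<And>m. coeff (P m) 0 = c m" "\<And>m. coeff (P m) 1 = Y m"
    "\<And>t. t \<noteq> 0 \<Longrightarrow> ev (\<lambda>m. poly (P m) t) = 0"
    using curve[of Y] by auto
  have "\<forall>m. \<exists>z. P m = pCons (c m) z"
    by (metis P(1) coeff_pCons_0 pCons_cases)
  then obtain Z where Z: "\<And>m. P m = pCons (c m) (Z m)" by metis
  have Z0: "poly (Z m) 0 = Y m" for m using P(2)[of m] by (simp add: Z poly_0_coeff_0)
  have "coeff (Q Z) e' = 0" if "e' < e" for e'
    by (rule poly_eq_0_infinite[OF inf]) (simp add: spec least[OF that])
  hence "monom 1 e dvd Q Z" by (simp add: monom_1_dvd_iff')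
  then obtain R where R: "Q Z = monom 1 e * R" by (elim dvdE)
  define W where "W = poly R [:0, 1:]"
  have "t ^ e * poly W t = ev (\<lambda>m. poly (P m) t)" for t
    using Q'[of Z t] by (simp add: R poly_monom W_def Z)
  hence "poly W t = 0" if "t \<noteq> 0" for t using P(3)[OF that] that by (metis mult_eq_0_iff power_not_zero)
  hence "W = 0" by (rule poly_eq_0_infinite[OF inf])
  moreover have "poly (poly R [:0, 1:]) 0 = poly (coeff R 0) 0"
    by (cases R) simp
  moreover have "coeff R 0 = coeff (Q Z) e" by (simp add: R coeff_monom_mult)
  ultimately show False using Y spec[of Z e 0] by (simp add: W_def Z0)
qed

text \<open>
  The vectors \<open>x2\<close>, \<open>y2\<close>, \<open>z2\<close> leave room for a correction of second order, which affects neither of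
  the two lowest coefficients.
\<close>

lemma trilin_curve:
  fixes b :: "nat \<Rightarrow> nat \<Rightarrow> nat \<Rightarrow> 'a::field"
  shows "\<exists>p. coeff p 0 = trilin b x0 y0 z0 \<and>
    coeff p 1 = trilin b x1 y0 z0 + trilin b x0 y1 z0 + trilin b x0 y0 z1 \<and>
    (\<forall>t. poly p t = trilin b (x0 + kscale t x1 + kscale (t ^ 2) x2)
        (y0 + kscale t y1 + kscale (t ^ 2) y2) (z0 + kscale t z1 + kscale (t ^ 2) z2))"
proof -
  define c where "c w0 w1 w2 d = (if d = 0 then w0 else if d = 1 then w1 else w2)"
    for w0 w1 w2 :: "'a kinf" and d :: nat
  define p where "p = (\<Sum>d\<in>{0, 1, 2}. \<Sum>d'\<in>{0, 1, 2}. \<Sum>d''\<in>{0, 1, 2}.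
    monom (trilin b (c x0 x1 x2 d) (c y0 y1 y2 d') (c z0 z1 z2 d'')) (d + d' + d''))"
  have W: "w0 + kscale t w1 + kscale (t ^ 2) w2 = (\<Sum>d\<in>{0, 1, 2}. kscale (t ^ d) (c w0 w1 w2 d))"
    for w0 w1 w2 t
    by (rule poly_mapping_eqI) (simp add: c_def lookup_add)
  show ?thesis
  proof (intro exI[of _ p] conjI allI)
    show "coeff p 0 = trilin b x0 y0 z0"
      by (simp add: p_def c_def coeff_sum)
    show "coeff p 1 = trilin b x1 y0 z0 + trilin b x0 y1 z0 + trilin b x0 y0 z1"
      by (simp add: p_def c_def coeff_sum)
    fix t
    show "poly p t = trilin b (x0 + kscale t x1 + kscale (t ^ 2) x2)
        (y0 + kscale t y1 + kscale (t ^ 2) y2) (z0 + kscale t z1 + kscale (t ^ 2) z2)"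
      unfolding W trilin_sum1 trilin_kscale1
      unfolding trilin_sum2 trilin_kscale2
      unfolding trilin_sum3 trilin_kscale3 p_def poly_sum poly_monom sum_distrib_left
      by (intro sum.cong refl) (simp add: power_add mult_ac)
  qed
qed

text \<open>
  Given a direction \<open>Y\<close>, indexed by cubic monomials, the vectors \<open>v\<^sub>i\<close> are moved by \<open>t \<psi>\<^sub>i\<close> with
  \<open>\<psi>\<^sub>i = (\<Sum>p. Y\<^bsub>ip\<^esub> / 3 w\<^sub>p)\<close>. Duality gives \<open>T v\<^sub>j v\<^sub>k \<psi>\<^sub>i = Y\<^bsub>ijk\<^esub> / 3\<close>, and the three
  first-order terms of \<open>T v\<^sub>i v\<^sub>j v\<^sub>k\<close> add up to \<open>Y\<^bsub>ijk\<^esub>\<close>.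
\<close>

lemma coord_eval_zero_of_orbit_zero:
  fixes b :: "nat \<Rightarrow> nat \<Rightarrow> nat \<Rightarrow> 'a::alg_closed_field"
  assumes "symmetric_trilinear b"
    and char: "CHAR('a) \<noteq> 2" "CHAR('a) \<noteq> 3"
    and \<Phi>: "\<Phi> \<in> coord_ring 3"
    and n: "\<And>M m i. M \<in> Poly_Mapping.keys \<Phi> \<Longrightarrow> m \<in># M \<Longrightarrow> i \<in># m \<Longrightarrow> i < n"
    and q: "q_rank (\<lambda>x. trilin b x x x) > enat (2 * card {(i, j). i \<le> j \<and> j < n})"
    and orbit: "\<And>g. g \<in> GL_inf \<Longrightarrow> coord_eval 3 \<Phi> ((\<lambda>x. trilin b x x x) \<circ> g) = 0"
  shows "coord_eval 3 \<Phi> h = 0"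
proof -
  interpret symmetric_trilinear b by fact
  have inf: "infinite (UNIV :: 'a set)" by (rule infinite_UNIV_alg_closed)
  define S where "S = {(i, j). i \<le> j \<and> j < n}"
  have "finite S" by (rule finite_subset[of _ "{..<n} \<times> {..<n}"]) (auto simp: S_def)
  obtain v w where "\<forall>(i, j)\<in>S. \<forall>p\<in>S. T (v i) (v j) (w p) = (if p = (i, j) then 1 else 0)"
    by (rule dual_system_of_high_q_rank[OF inf q, folded S_def])
  hence vw: "T (v i) (v j) (w p) = (if p = (i, j) then 1 else 0)" if "(i, j) \<in> S" "p \<in> S" for i j p
    using that by blast
  define \<mu> :: "nat multiset \<Rightarrow> 'a" where "\<mu> m = of_nat (card (triples m))" for m
  have "\<forall>m. \<exists>i j k. size m = 3 \<longrightarrow> m = {#i, j, k :: nat#}"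
    by (meson size_3_multiset)
  then obtain i j k where ijk: "\<And>m. size m = 3 \<Longrightarrow> m = {#i m, j m, k m :: nat#}"
    by metis
  \<comment> \<open>Only the cubic monomials in the first \<open>n\<close> variables matter for \<open>\<Phi>\<close>.\<close>
  define rel where "rel m \<longleftrightarrow> size m = 3 \<and> set_mset m \<subseteq> {..<n}" for m :: "nat multiset"
  have rel: "rel m" if "M \<in> Poly_Mapping.keys \<Phi>" "m \<in># M" for M m
    using that n \<Phi> by (auto simp: rel_def coord_ring_def)
  have index_less: "i m < n" "j m < n" "k m < n" if "rel m" for m
    using that arg_cong[OF ijk[of m], of set_mset] by (auto simp: rel_def)
  define ev where "ev y = (\<Sum>M\<in>Poly_Mapping.keys \<Phi>. Poly_Mapping.lookup \<Phi> M *
      (\<Prod>m\<in>#M. \<mu> m * y m))" for y :: "nat multiset \<Rightarrow> 'a"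
  have coord_eval_ev: "coord_eval 3 \<Phi> f = ev y"
    if "\<And>m. rel m \<Longrightarrow> coeff_of 3 f m = \<mu> m * y m" for f y
    unfolding coord_eval_def ev_def
  proof (rule sum.cong[OF refl])
    fix M assume M: "M \<in> Poly_Mapping.keys \<Phi>"
    have "image_mset (coeff_of 3 f) M = image_mset (\<lambda>m. \<mu> m * y m) M"
      using that rel[OF M] by (intro image_mset_cong) auto
    thus "Poly_Mapping.lookup \<Phi> M * (\<Prod>m\<in>#M. coeff_of 3 f m)
        = Poly_Mapping.lookup \<Phi> M * (\<Prod>m\<in>#M. \<mu> m * y m)" by simp
  qed
  have "ev (\<lambda>m. coeff_of 3 h m / \<mu> m) = 0"
    unfolding ev_def
  proof (rule zero_of_zero_on_curves[OF inf, where c = "\<lambda>m. T (v (i m)) (v (j m)) (v (k m))"],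
      unfold ev_def[symmetric])
    fix Y :: "nat multiset \<Rightarrow> 'a"
    define \<psi> where "\<psi> l = (\<Sum>p\<in>S. kscale (Y {#l, fst p, snd p#} / 3) (w p))" for l
    have T\<psi>: "T (v l') (v l'') (\<psi> l) = Y {#l, l', l''#} / 3" if "l' < n" "l'' < n" for l l' l''
    proof -
      have *: "T (v l') (v l'') (\<psi> l) = Y {#l, l', l''#} / 3" if "(l', l'') \<in> S" for l' l''
        unfolding \<psi>_def trilin_sum3 trilin_kscale3 using that \<open>finite S\<close>
        by (simp add: vw if_distrib cong: if_cong)
      show ?thesis
      proof (cases "l' \<le> l''")
        case True
        thus ?thesis using that by (intro *) (simp add: S_def)
      next
        case False
        have "T (v l') (v l'') (\<psi> l) = T (v l'') (v l') (\<psi> l)" by (rule T12)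
        also have "\<dots> = Y {#l, l'', l'#} / 3" using False that by (intro *) (simp add: S_def)
        also have "{#l, l'', l'#} = {#l, l', l''#}" by (simp add: add_mset_commute)
        finally show ?thesis .
      qed
    qed
    let ?K = "insert n (\<Union>l<n. Poly_Mapping.keys (v l) \<union> Poly_Mapping.keys (\<psi> l))"
    have "finite ?K" by simp
    then obtain N where N: "\<And>l. l \<in> ?K \<Longrightarrow> l < N"
      unfolding finite_nat_set_iff_bounded by auto
    \<comment> \<open>The fresh basis vectors that make the substitution invertible for \<open>t \<noteq> 0\<close>.\<close>
    define \<delta> :: "nat \<Rightarrow> 'a kinf" where "\<delta> l = Poly_Mapping.single (N + l) 1" for l
    define u where "u t l = v l + kscale t (\<psi> l) + kscale (t ^ 2) (\<delta> l)" for t l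
    have "\<forall>m. \<exists>p. coeff p 0 = T (v (i m)) (v (j m)) (v (k m)) \<and> coeff p 1 = Y m \<and>
        (rel m \<longrightarrow> (\<forall>t. poly p t = T (u t (i m)) (u t (j m)) (u t (k m))))"
    proof
      fix m
      show "\<exists>p. coeff p 0 = T (v (i m)) (v (j m)) (v (k m)) \<and> coeff p 1 = Y m \<and>
        (rel m \<longrightarrow> (\<forall>t. poly p t = T (u t (i m)) (u t (j m)) (u t (k m))))"
      proof (cases "rel m")
        case True
        hence m: "m = {#i m, j m, k m#}" using ijk by (simp add: rel_def)
        note lt = index_less[OF True]
        obtain p where p: "coeff p 0 = T (v (i m)) (v (j m)) (v (k m))"
          "coeff p 1 = T (\<psi> (i m)) (v (j m)) (v (k m)) + T (v (i m)) (\<psi> (j m)) (v (k m))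
              + T (v (i m)) (v (j m)) (\<psi> (k m))"
          "\<And>t. poly p t = T (u t (i m)) (u t (j m)) (u t (k m))"
          using trilin_curve[where b = b and ?x0.0 = "v (i m)" and ?x1.0 = "\<psi> (i m)" and ?x2.0 = "\<delta> (i m)"
              and ?y0.0 = "v (j m)" and ?y1.0 = "\<psi> (j m)" and ?y2.0 = "\<delta> (j m)"
              and ?z0.0 = "v (k m)" and ?z1.0 = "\<psi> (k m)" and ?z2.0 = "\<delta> (k m)"]
          unfolding u_def by blast
        have perm: "{#j m, i m, k m#} = m" "{#k m, i m, j m#} = m"
          by (rule trans[OF _ m[symmetric]], simp add: add_mset_commute)+
        have "T (\<psi> (i m)) (v (j m)) (v (k m)) = Y m / 3"
          using T\<psi>[OF lt(2,3), of "i m"] m[symmetric] T12[of "\<psi> (i m)"] T23[of "v (j m)" "\<psi> (i m)"]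
          by simp
        moreover have "T (v (i m)) (\<psi> (j m)) (v (k m)) = Y m / 3"
          using T\<psi>[OF lt(1,3), of "j m"] perm(1) T23[of _ "\<psi> (j m)"] by simp
        moreover have "T (v (i m)) (v (j m)) (\<psi> (k m)) = Y m / 3"
          using T\<psi>[OF lt(1,2), of "k m"] perm(2) by simp
        ultimately have "coeff p 1 = Y m / 3 + Y m / 3 + Y m / 3" by (simp only: p(2))
        hence "coeff p 1 = Y m" using two_three_nonzero(2)[OF char] by (simp add: field_simps)
        thus ?thesis using p(1,3) by blast
      next
        case False
        thus ?thesis by (intro exI[of _ "[:T (v (i m)) (v (j m)) (v (k m)), Y m:]"]) simp
      qed
    qed
    from choice[OF this] obtain P where P: "\<And>m. coeff (P m) 0 = T (v (i m)) (v (j m)) (v (k m))"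
      "\<And>m. coeff (P m) 1 = Y m"
      "\<And>m t. rel m \<Longrightarrow> poly (P m) t = T (u t (i m)) (u t (j m)) (u t (k m))"
      by blast
    have "ev (\<lambda>m. poly (P m) t) = 0" if "t \<noteq> 0" for t
    proof -
      \<comment> \<open>Sends the first \<open>n\<close> basis vectors to the points \<open>u t l\<close> of the curve.\<close>
      define G where "G l = (if l < n then (v l + kscale t (\<psi> l)) + Poly_Mapping.single (N + l) (t ^ 2)
                   else if N \<le> l \<and> l < N + n then Poly_Mapping.single (l - N) 1
                   else Poly_Mapping.single l 1)" for l
      have Gu: "G l = u t l" if "l < n" for l
        using that by (intro poly_mapping_eqI)
          (simp add: G_def u_def \<delta>_def lookup_add lookup_single when_def)
      have "linear_extension G \<in> GL_inf"
        unfolding G_def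
      proof (rule linear_extension_in_GL_inf)
        show "n \<le> N" using N[of n] by simp
        show "t ^ 2 \<noteq> 0" using that by simp
        fix l assume l: "l < n"
        have "Poly_Mapping.keys (v l + kscale t (\<psi> l)) \<subseteq> Poly_Mapping.keys (v l) \<union> Poly_Mapping.keys (\<psi> l)"
          by (auto simp: in_keys_iff lookup_add)
        thus "Poly_Mapping.keys (v l + kscale t (\<psi> l)) \<subseteq> {..<N}" using N l by blast
      qed
      hence "coord_eval 3 \<Phi> ((\<lambda>x. T x x x) \<circ> linear_extension G) = 0" by (rule orbit)
      moreover have "coord_eval 3 \<Phi> ((\<lambda>x. T x x x) \<circ> linear_extension G) = ev (\<lambda>m. poly (P m) t)"
      proof (rule coord_eval_ev)
        fix m assume m: "rel m"
        hence m3: "m = {#i m, j m, k m#}" using ijk by (simp add: rel_def)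
        note lt = index_less[OF m]
        have "(\<lambda>x. T x x x) \<circ> linear_extension G = (\<lambda>x. trilin (\<lambda>i j k. T (G i) (G j) (G k)) x x x)"
          by (simp add: fun_eq_iff trilin_linear_extension)
        moreover have "coeff_of 3 (\<lambda>x. trilin (\<lambda>i j k. T (G i) (G j) (G k)) x x x) {#i m, j m, k m#}
            = of_nat (card (triples {#i m, j m, k m#})) * T (G (i m)) (G (j m)) (G (k m))"
          by (rule coeff_of_trilin) (rule T12 T23)+
        ultimately show "coeff_of 3 ((\<lambda>x. T x x x) \<circ> linear_extension G) m = \<mu> m * poly (P m) t"
          using m3 by (simp add: \<mu>_def P(3)[OF m] Gu lt)
      qed
      ultimately show ?thesis by simp
    qed
    thus "\<exists>P. (\<forall>m. coeff (P m) 0 = T (v (i m)) (v (j m)) (v (k m)) \<and> coeff (P m) 1 = Y m) \<and>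
        (\<forall>t. t \<noteq> 0 \<longrightarrow> ev (\<lambda>m. poly (P m) t) = 0)"
      using P(1,2) by blast
  qed
  moreover have "coord_eval 3 \<Phi> h = ev (\<lambda>m. coeff_of 3 h m / \<mu> m)"
    using card_triples_nonzero[OF char] by (intro coord_eval_ev) (simp add: rel_def \<mu>_def)
  ultimately show ?thesis by simp
qed

theorem theorem1p7:
  fixes X :: "('a::alg_closed_field kinf \<Rightarrow> 'a) set"
  assumes "CHAR('a) \<noteq> 2" and "CHAR('a) \<noteq> 3"
    and "X \<subseteq> homog_poly 3" and "GL_stable X"
    and "\<And>N::nat. \<exists>f\<in>X. q_rank f \<ge> enat N"
  shows "zariski 3 closure_of X = homog_poly 3"
proof -
  have vanish: "coord_eval 3 \<Phi> h = 0"
    if \<Phi>: "\<Phi> \<in> coord_ring 3" and zero: "\<And>f. f \<in> X \<Longrightarrow> coord_eval 3 \<Phi> f = 0" for \<Phi> h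
  proof -
    have "finite (\<Union>M\<in>Poly_Mapping.keys \<Phi>. \<Union>m\<in>set_mset M. set_mset m)"
      by (intro finite_UN_I finite_keys finite_set_mset)
    then obtain n where "\<forall>i\<in>(\<Union>M\<in>Poly_Mapping.keys \<Phi>. \<Union>m\<in>set_mset M. set_mset m). i < n"
      unfolding finite_nat_set_iff_bounded ..
    hence n: "\<And>M m i. M \<in> Poly_Mapping.keys \<Phi> \<Longrightarrow> m \<in># M \<Longrightarrow> i \<in># m \<Longrightarrow> i < n" by blast
    let ?r = "2 * card {(i, j). i \<le> j \<and> j < n}"
    obtain f where f: "f \<in> X" "q_rank f \<ge> enat (Suc ?r)" using assms(5) by blast
    obtain b where b: "symmetric_trilinear b" "f = (\<lambda>x. trilin b x x x)"
      by (rule cubic_polarisation[OF assms(1,2) subsetD[OF assms(3) f(1)]])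
    show ?thesis
    proof (rule coord_eval_zero_of_orbit_zero[OF _ assms(1,2) \<Phi> n])
      show "symmetric_trilinear b" by (rule b(1))
      have "enat ?r < enat (Suc ?r)" by simp
      thus "enat ?r < q_rank (\<lambda>x. trilin b x x x)" using f(2) unfolding b(2) by (rule less_le_trans)
      fix g :: "'a kinf \<Rightarrow> 'a kinf" assume "g \<in> GL_inf"
      thus "coord_eval 3 \<Phi> ((\<lambda>x. trilin b x x x) \<circ> g) = 0"
        using f(1) assms(4) zero unfolding b(2) GL_stable_def by blast
    qed
  qed
  show ?thesis
  proof
    show "zariski 3 closure_of X \<subseteq> homog_poly 3"
      using closure_of_subset_topspace[of "zariski 3" X] by simp
    show "homog_poly 3 \<subseteq> zariski 3 closure_of X"
    proof
      fix h :: "'a kinf \<Rightarrow> 'a" assume h: "h \<in> homog_poly 3"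
      have "\<exists>y. y \<in> X \<and> y \<in> U" if U: "h \<in> U" "openin (zariski 3) U" for U
      proof (rule ccontr)
        assume disjoint: "\<not> ?thesis"
        obtain F where F: "F \<subseteq> coord_ring 3" "homog_poly 3 - U = zero_locus 3 F"
          using U(2) by (auto simp: openin_zariski)
        hence "X \<subseteq> zero_locus 3 F" using disjoint assms(3) by blast
        have "coord_eval 3 \<Phi> h = 0" if "\<Phi> \<in> F" for \<Phi>
        proof (rule vanish)
          show "\<Phi> \<in> coord_ring 3" using that F(1) by blast
          show "coord_eval 3 \<Phi> f = 0" if "f \<in> X" for f
            using that \<open>\<Phi> \<in> F\<close> \<open>X \<subseteq> zero_locus 3 F\<close> by (auto simp: zero_locus_def)
        qed
        hence "h \<in> zero_locus 3 F" using h by (simp add: zero_locus_def)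
        thus False using F(2) U(1) by blast
      qed
      thus "h \<in> zariski 3 closure_of X" using h by (simp add: in_closure_of)
    qed
  qed
qed

end
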